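(* Let $(V,\{M_n(V)^+\},e,\{|\cdot|_n\})$ be an absolute matrix order unit space. Let $(\mathfrak V,\mathfrak V^+)$, with maps $T_n:M_n(V)\to\mathfrak V$, be the matricial inductive limit of $(V,\{M_n(V)^+\})$, and let $|\mathfrak v|:=T_{o(\mathfrak v)}(|T_{o(\mathfrak v)}^{-1}(\mathfrak v)|_{o(\mathfrak v)})$ for $\mathfrak v\in\mathfrak V$. Then $(\mathfrak V,\mathfrak V^+,T_1(e),|\cdot|)$ is a non-degenerate absolute order unital $\mathfrak F$-bimodule.
   Context: **Bimodules.** $\mathfrak F$ is the $*$-algebra of all $\infty\times\infty$ complex matrices with at most finitely many non-zero entries, with conjugate transpose $*$ and operator norm $\|\cdot\|$; $\mathfrak e_{i,j}$ are its matrix units, $\mathfrak I_n=\sum_{i=1}^n\mathfrak e_{i,i}$ and $\mathfrak J_n=\sum_{i=1}^n\mathfrak e_{i,n+i}$. An $\mathfrak F$-bimodule $\mathfrak V$ is non-degenerate if for every $\mathfrak v\in\mathfrak V$ there is $n$ with $\mathfrak I_n\mathfrak v\mathfrak I_n=\mathfrak v$; the least such $n\in\mathbb N$ is the order $o(\mathfrak v)$. It is a complex vector space via $\alpha\mathfrak v=(\alpha\mathfrak I_n)\mathfrak v$ for any such $n$. A $*$-$\mathfrak F$-bimodule has an additive map $*$ with $(\mathfrak a\mathfrak v)^*=\mathfrak v^*\mathfrak a^*$, $(\mathfrak v\mathfrak a)^*=\mathfrak a^*\mathfrak v^*$, $\mathfrak v^{**}=\mathfrak v$; $\mathfrak V_{sa}=\{\mathfrak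 v:\mathfrak v^*=\mathfrak v\}$. An ordered $\mathfrak F$-bimodule $(\mathfrak V,\mathfrak V^+)$ is a $*$-$\mathfrak F$-bimodule with $\mathfrak V^+\subset\mathfrak V_{sa}$ closed under addition and under $\mathfrak v\mapsto\mathfrak a^*\mathfrak v\mathfrak a$ ($\mathfrak a\in\mathfrak F$); $\mathfrak u\le\mathfrak v$ means $\mathfrak v-\mathfrak u\in\mathfrak V^+$. $\mathfrak V^+$ is proper if $\mathfrak V^+\cap(-\mathfrak V^+)=\{0\}$, and Archimedean if whenever $\mathfrak v\in\mathfrak V_{sa}$, $\mathfrak u\in\mathfrak V^+$ and $k\mathfrak u+\mathfrak v\in\mathfrak V^+$ for all real $k>0$, then $\mathfrak v\in\mathfrak V^+$. For $\mathfrak v_1,\mathfrak v_2\in\mathfrak V^+$ and $\mathfrak v\in\mathfrak V$, all fixed by $\mathfrak x\mapsto\mathfrak I_n\mathfrak x\mathfrak I_n$, put $(\mathfrak v_1,\mathfrak v_2)_n^+=\mathfrak v_1+\mathfrak J_n^*\mathfrak v_2\mathfrak J_n$ and $sa_n(\mathfrak v)=\mathfrak I_n\mathfrak v\mathfrak J_n+\mathfrak J_n^*\mathfrak v^*\mathfrak I_n$. Elements $\mathfrak u,\mathfrak v\in\mathfrak V$ are $\mathfrak F$-independent if there are disjoint (finite) $I,J\subset\mathbb N$ with $\mathfrak r\mathfrak u\mathfrak r=\mathfrak u$, $\mathfrak s\mathfrak v\mathfrak s=\mathfrak v$, where $\mathfrak r=\sum_{i\in I}\mathfrak e_{i,i}$,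 $\mathfrak s=\sum_{j\in J}\mathfrak e_{j,j}$. A *non-degenerate absolutely ordered $\mathfrak F$-bimodule* $(\mathfrak V,\mathfrak V^+,|\cdot|)$ is a non-degenerate ordered $\mathfrak F$-bimodule with a map $|\cdot|:\mathfrak V\to\mathfrak V^+$ such that: (1) $o(|\mathfrak v|)\le o(\mathfrak v)$; (2) $|\mathfrak v|=\mathfrak v$ for $\mathfrak v\in\mathfrak V^+$; (3) $(|\mathfrak v^*|,|\mathfrak v|)^+_{o(\mathfrak v)}+sa_{o(\mathfrak v)}(\mathfrak v)\in\mathfrak V^+$ for all $\mathfrak v$; (4) $|\mathfrak a\mathfrak v\mathfrak b|\le\|\mathfrak a\|\,\big||\mathfrak v|\mathfrak b\big|$ for $\mathfrak v\in\mathfrak V$, $\mathfrak a,\mathfrak b\in\mathfrak F$; (5) $|\mathfrak u+\mathfrak v|=|\mathfrak u|+|\mathfrak v|$ for $\mathfrak F$-independent $\mathfrak u,\mathfrak v$; (6) for $\mathfrak u,\mathfrak v,\mathfrak w\in\mathfrak V^+$ with $|\mathfrak u-\mathfrak v|=\mathfrak u+\mathfrak v$ and $0\le\mathfrak w\le\mathfrak v$: $|\mathfrak u-\mathfrak w|=\mathfrak u+\mathfrak w$; (7) for $\mathfrak u,\mathfrak v,\mathfrak w\in\mathfrak V^+$ with $|\mathfrak u-\mathfrak v|=\mathfrak u+\mathfrak v$ and $|\mathfrak u-\mathfrak w|=\mathfrak u+\mathfrak w$: $\big|\mathfrak u-|\mathfrak v\pm\mathfrak w|\big|=\mathfrak u+|\mathfrak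 v\pm\mathfrak w|$. For $\mathfrak u,\mathfrak v\in\mathfrak V^+$, $\mathfrak u\perp\mathfrak v$ means $|\mathfrak u-\mathfrak v|=\mathfrak u+\mathfrak v$. A *local order unit* for a non-degenerate ordered $\mathfrak F$-bimodule is $\mathfrak e\in\mathfrak V^+$ with $\mathfrak I_1\mathfrak e\mathfrak I_1=\mathfrak e$ such that for each $\mathfrak v\in\mathfrak I_1\mathfrak V\mathfrak I_1$ there is $k>0$ with $(k\mathfrak e,k\mathfrak e)_1^++sa_1(\mathfrak v)\in\mathfrak V^+$. If in addition $\mathfrak V^+$ is proper and Archimedean, $(\mathfrak V,\mathfrak V^+,\mathfrak e)$ is a *local $\mathfrak F$-order unit bimodule*; with $\mathfrak e^n:=\sum_{i=1}^n\mathfrak e_{i,1}\mathfrak e\mathfrak e_{1,i}$ it carries the norm $\|\mathfrak v\|=\inf\{k>0:(k\mathfrak e^{o(\mathfrak v)},k\mathfrak e^{o(\mathfrak v)})^+_{o(\mathfrak v)}+sa_{o(\mathfrak v)}(\mathfrak v)\in\mathfrak V^+\}$. For $\mathfrak u,\mathfrak v\in\mathfrak V^+$: $\mathfrak u\perp_\infty\mathfrak v$ means $\|k_1\mathfrak u+k_2\mathfrak v\|=\max\{\|k_1\mathfrak u\|,\|k_2\mathfrak v\|\}$ for all $k_1,k_2\in\mathbb R$; $\mathfrak u\perp_\infty^a\mathfrak v$ means $\mathfrak u_1\perp_\infty\mathfrak v_1$ for all $\mathfrak u_1,\mathfrak v_1\in\mathfrak V^+$ with $\mathfrak u_1\le\mathfrak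 u$, $\mathfrak v_1\le\mathfrak v$. $(\mathfrak V,\mathfrak V^+,\mathfrak e,|\cdot|)$ is a *non-degenerate absolute order unital $\mathfrak F$-bimodule* if $(\mathfrak V,\mathfrak V^+,\mathfrak e)$ is a local $\mathfrak F$-order unit bimodule, $(\mathfrak V,\mathfrak V^+,|\cdot|)$ is a non-degenerate absolutely ordered $\mathfrak F$-bimodule, and $\perp=\perp_\infty^a$ on $\mathfrak V^+$. **Matrix side.** $M_{m,n}(V)$ denotes $m\times n$ matrices over $V$, $M_{m,n}=M_{m,n}(\mathbb C)$, $v\oplus w$ is the block diagonal matrix. A matrix ordered space is a complex vector space $V$ with involution (with $[v_{ij}]^*=[v_{ji}^*]$ on matrices) and cones $M_n(V)^+\subset M_n(V)_{sa}$ such that each $(M_n(V)_{sa},M_n(V)^+)$ is a real ordered vector space and $a^*va\in M_m(V)^+$ for $v\in M_n(V)^+$, $a\in M_{n,m}$. It is a matrix order unit space $(V,\{M_n(V)^+\},e)$ if $e\in V^+$ is an order unit for $V_{sa}$, $V^+$ is proper and every $M_n(V)^+$ is Archimedean; put $e^n=e\oplus\cdots\oplus e\in M_n(V)$ and $\|v\|_n=\inf\left\{k>0:\begin{bmatrix} ke^n & v \\ v^* & ke^n \end{bmatrix}\in M_{2n}(V)^+\right\}$. An absolutely ordered space $(X,X^+,|\cdot|)$ is a real ordered vector space with $|\cdot|:X\to X^+$ such that: $|v|=v$ for $v\in X^+$; $|v|\pm v\in X^+$; $|kv|=|k||v|$ for $k\in\mathbb R$; if $|u-v|=u+v$ and $0\le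 w\le v$ then $|u-w|=u+w$; if $|u-v|=u+v$ and $|u-w|=u+w$ then $\big|u-|v\pm w|\big|=u+|v\pm w|$. An absolutely matrix ordered space is a matrix ordered space with maps $|\cdot|_{m,n}:M_{m,n}(V)\to M_n(V)^+$ ($|\cdot|_n:=|\cdot|_{n,n}$) such that: (1) each $(M_n(V)_{sa},M_n(V)^+,|\cdot|_n)$ is an absolutely ordered space; (2) $|\alpha v\beta|_{r,s}\le\|\alpha\|\,\big||v|_{m,n}\beta\big|_{n,s}$ for $v\in M_{m,n}(V)$, $\alpha\in M_{r,m}$, $\beta\in M_{n,s}$; (3) $|v\oplus w|_{m+r,n+s}=|v|_{m,n}\oplus|w|_{r,s}$. The square maps determine the rectangular ones, so only $\{|\cdot|_n\}$ is displayed. An *absolute matrix order unit space* is a matrix order unit space that is an absolutely matrix ordered space and for which $\perp=\perp_\infty^a$ on every $M_n(V)^+$, where for $u,v\in M_n(V)^+$: $u\perp v$ means $|u-v|_n=u+v$; $u\perp_\infty v$ means $\|k_1u+k_2v\|_n=\max\{\|k_1u\|_n,\|k_2v\|_n\}$ for all $k_1,k_2\in\mathbb R$; and $u\perp_\infty^a v$ means $u_1\perp_\infty v_1$ for all $u_1,v_1\in M_n(V)^+$ with $u_1\le u$, $v_1\le v$. **Matricial inductive limit.** $\mathfrak V$ is the direct limit of the maps $M_n(V)\to M_{n+m}(V)$, $v\mapsto v\oplus0_m$; i.e. $\infty\times\infty$ matrices over $V$ with finitely many non-zero entries, with the obvious $\mathfrak F$-bimodule structure and involution; $T_n:M_n(V)\to\mathfrak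 V$ is the injective canonical map $v\mapsto v\oplus0$, with range $\mathfrak I_n\mathfrak V\mathfrak I_n$, and $\mathfrak V^+=\bigcup_nT_n(M_n(V)^+)$. *)

theory Defs
  imports
    "HOL-Analysis.L2_Norm"
    "HOL-Library.Poly_Mapping"
    "Jordan_Normal_Form.Matrix"
begin

text \<open>
  Conventions. The positive integers index matrix sizes, so every size below is required to be
  positive; in particular the order of an element of a bimodule is at least 1. Rows and columns
  are counted from 0, so the index \<open>i\<close> here is the index \<open>i + 1\<close> of the usual notation.
\<close>

section \<open>Infinite matrices with finitely many non-zero entries\<close>

type_synonym 'a finmat = "(nat \<times> nat) \<Rightarrow>\<^sub>0 'a"

text \<open>
  Matrix product with respect to a multiplication \<open>f\<close> of the entries. Only indices \<open>k\<close> with both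
  factors non-zero are summed, which makes the result finitely supported for every \<open>f\<close>; the other
  terms vanish whenever \<open>f\<close> is biadditive.
\<close>

lift_definition fin_mult ::
    "('a::zero \<Rightarrow> 'b::zero \<Rightarrow> 'c::comm_monoid_add) \<Rightarrow> 'a finmat \<Rightarrow> 'b finmat \<Rightarrow> 'c finmat"
  is "\<lambda>f a b (i, j). \<Sum>k | a (i, k) \<noteq> 0 \<and> b (k, j) \<noteq> 0. f (a (i, k)) (b (k, j))"
proof -
  fix f :: "'a \<Rightarrow> 'b \<Rightarrow> 'c" and a :: "nat \<times> nat \<Rightarrow> 'a" and b :: "nat \<times> nat \<Rightarrow> 'b"
  assume a: "finite {x. a x \<noteq> 0}" and b: "finite {x. b x \<noteq> 0}"
  let ?P = "\<lambda>(i, j). \<Sum>k | a (i, k) \<noteq> 0 \<and> b (k, j) \<noteq> 0. f (a (i, k)) (b (k, j))"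
  have "{x. ?P x \<noteq> 0} \<subseteq> fst ` {x. a x \<noteq> 0} \<times> snd ` {x. b x \<noteq> 0}"
  proof
    fix x assume x: "x \<in> {x. ?P x \<noteq> 0}"
    obtain i j where ij: "x = (i, j)" by (cases x)
    have "{k. a (i, k) \<noteq> 0 \<and> b (k, j) \<noteq> 0} \<noteq> {}"
    proof
      assume e: "{k. a (i, k) \<noteq> 0 \<and> b (k, j) \<noteq> 0} = {}"
      have "?P x = 0" unfolding ij prod.case e by simp
      with x show False by simp
    qed
    then obtain k where "a (i, k) \<noteq> 0" "b (k, j) \<noteq> 0" by blast
    then show "x \<in> fst ` {x. a x \<noteq> 0} \<times> snd ` {x. b x \<noteq> 0}"
      unfolding ij by (auto simp: image_iff)
  qed
  moreover have "finite (fst ` {x. a x \<noteq> 0} \<times> snd ` {x. b x \<noteq> 0})"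
    using a b by simp
  ultimately show "finite {x. ?P x \<noteq> 0}" by (rule finite_subset)
qed

definition fin_adj :: "('a::zero \<Rightarrow> 'a) \<Rightarrow> 'a finmat \<Rightarrow> 'a finmat" where
  "fin_adj s a = Poly_Mapping.map s (Poly_Mapping.map_key prod.swap a)"


section \<open>The algebra of finitely supported complex matrices\<close>

type_synonym F = "complex finmat"

definition F_mult :: "F \<Rightarrow> F \<Rightarrow> F" where
  "F_mult a b = fin_mult (*) a b"

definition F_scale :: "complex \<Rightarrow> F \<Rightarrow> F" where
  "F_scale \<alpha> a = Poly_Mapping.map ((*) \<alpha>) a"

definition F_adj :: "F \<Rightarrow> F" where
  "F_adj a = fin_adj cnj a"

text \<open>The operator norm of \<open>a\<close> acting on square summable sequences.\<close>

definition F_norm :: "F \<Rightarrow> real" where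
  "F_norm a = Sup {
      sqrt (suminf (\<lambda>i. (cmod (suminf (\<lambda>j. Poly_Mapping.lookup a (i, j) * x j)))\<^sup>2)) |
      x :: nat \<Rightarrow> complex.
      summable (\<lambda>j. (cmod (x j))\<^sup>2) \<and> suminf (\<lambda>j. (cmod (x j))\<^sup>2) \<le> 1}"

definition F_unit :: "nat \<Rightarrow> nat \<Rightarrow> F" where
  "F_unit i j = Poly_Mapping.single (i, j) 1"

definition F_diag :: "nat set \<Rightarrow> F" where
  "F_diag S = (\<Sum>i\<in>S. F_unit i i)"

definition F_I :: "nat \<Rightarrow> F" where
  "F_I n = F_diag {..<n}"

definition F_J :: "nat \<Rightarrow> F" where
  "F_J n = (\<Sum>i<n. F_unit i (n + i))"


section \<open>Bimodules\<close>

text \<open>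
  The axiom \<open>scalars\<close> says that the bimodule is balanced over the complex numbers, i.e. a
  bimodule over the algebra and not only over its underlying ring. It makes left and right
  multiplication by \<open>\<alpha>\<close> on a non-degenerate bimodule agree.
\<close>

locale F_bimodule =
  fixes lact :: "F \<Rightarrow> 'b::ab_group_add \<Rightarrow> 'b" (infixr "\<triangleright>" 75)
    and ract :: "'b \<Rightarrow> F \<Rightarrow> 'b" (infixl "\<triangleleft>" 74)
  assumes lact_add_left: "(a + b) \<triangleright> v = (a \<triangleright> v) + (b \<triangleright> v)"
    and lact_add_right: "a \<triangleright> (v + w) = (a \<triangleright> v) + (a \<triangleright> w)"
    and lact_mult: "F_mult a b \<triangleright> v = a \<triangleright> (b \<triangleright> v)"
    and ract_add_left: "(v + w) \<triangleleft> a = (v \<triangleleft> a) + (w \<triangleleft> a)"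
    and ract_add_right: "v \<triangleleft> (a + b) = (v \<triangleleft> a) + (v \<triangleleft> b)"
    and ract_mult: "v \<triangleleft> F_mult a b = (v \<triangleleft> a) \<triangleleft> b"
    and lact_ract: "(a \<triangleright> v) \<triangleleft> b = a \<triangleright> (v \<triangleleft> b)"
    and scalars: "(F_scale \<alpha> a \<triangleright> v) \<triangleleft> b = (a \<triangleright> v) \<triangleleft> F_scale \<alpha> b"
begin

definition elt_order :: "'b \<Rightarrow> nat" where
  "elt_order v = (LEAST n. 0 < n \<and> F_I n \<triangleright> v \<triangleleft> F_I n = v)"

definition scl :: "complex \<Rightarrow> 'b \<Rightarrow> 'b" where
  "scl \<alpha> v = F_scale \<alpha> (F_I (elt_order v)) \<triangleright> v"

definition rscl :: "real \<Rightarrow> 'b \<Rightarrow> 'b" where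
  "rscl k v = scl (complex_of_real k) v"

definition F_independent :: "'b \<Rightarrow> 'b \<Rightarrow> bool" where
  "F_independent u v \<longleftrightarrow> (\<exists>S T. finite S \<and> finite T \<and> S \<inter> T = {} \<and>
     F_diag S \<triangleright> u \<triangleleft> F_diag S = u \<and> F_diag T \<triangleright> v \<triangleleft> F_diag T = v)"

definition pair_pos :: "nat \<Rightarrow> 'b \<Rightarrow> 'b \<Rightarrow> 'b" where
  "pair_pos n v\<^sub>1 v\<^sub>2 = v\<^sub>1 + (F_adj (F_J n) \<triangleright> v\<^sub>2 \<triangleleft> F_J n)"

definition corner_unit :: "'b \<Rightarrow> nat \<Rightarrow> 'b" where
  "corner_unit e n = (\<Sum>i<n. F_unit i 0 \<triangleright> e \<triangleleft> F_unit 0 i)"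

end

locale nondegenerate_F_bimodule = F_bimodule +
  assumes nondegenerate: "\<exists>n>0. F_I n \<triangleright> v \<triangleleft> F_I n = v"

locale star_F_bimodule = F_bimodule lact ract
  for lact :: "F \<Rightarrow> 'b::ab_group_add \<Rightarrow> 'b" (infixr "\<triangleright>" 75)
    and ract :: "'b \<Rightarrow> F \<Rightarrow> 'b" (infixl "\<triangleleft>" 74) +
  fixes star :: "'b \<Rightarrow> 'b"
  assumes star_add: "star (v + w) = star v + star w"
    and star_lact: "star (a \<triangleright> v) = star v \<triangleleft> F_adj a"
    and star_ract: "star (v \<triangleleft> a) = F_adj a \<triangleright> star v"
    and star_star: "star (star v) = v"
begin

definition sa_part :: "nat \<Rightarrow> 'b \<Rightarrow> 'b" where
  "sa_part n v = (F_I n \<triangleright> v \<triangleleft> F_J n) + (F_adj (F_J n) \<triangleright> star v \<triangleleft> F_I n)"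

end

locale ordered_F_bimodule = star_F_bimodule lact ract star
  for lact :: "F \<Rightarrow> 'b::ab_group_add \<Rightarrow> 'b" (infixr "\<triangleright>" 75)
    and ract :: "'b \<Rightarrow> F \<Rightarrow> 'b" (infixl "\<triangleleft>" 74)
    and star +
  fixes P :: "'b set"
  assumes P_sa: "v \<in> P \<Longrightarrow> star v = v"
    and P_add: "v \<in> P \<Longrightarrow> w \<in> P \<Longrightarrow> v + w \<in> P"
    and P_compress: "v \<in> P \<Longrightarrow> F_adj a \<triangleright> v \<triangleleft> a \<in> P"
begin

definition le :: "'b \<Rightarrow> 'b \<Rightarrow> bool" where
  "le u v \<longleftrightarrow> v - u \<in> P"

end

locale nondegenerate_ordered_F_bimodule =
  nondegenerate_F_bimodule lact ract + ordered_F_bimodule lact ract star P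
  for lact ract star P

locale nondegenerate_absolutely_ordered_F_bimodule =
  nondegenerate_ordered_F_bimodule lact ract star P
  for lact :: "F \<Rightarrow> 'b::ab_group_add \<Rightarrow> 'b" (infixr "\<triangleright>" 75)
    and ract :: "'b \<Rightarrow> F \<Rightarrow> 'b" (infixl "\<triangleleft>" 74)
    and star P +
  fixes av :: "'b \<Rightarrow> 'b"
  assumes av_pos: "av v \<in> P"
    and av_order: "elt_order (av v) \<le> elt_order v"
    and av_fix: "v \<in> P \<Longrightarrow> av v = v"
    and av_block:
      "pair_pos (elt_order v) (av (star v)) (av v) + sa_part (elt_order v) v \<in> P"
    and av_mult: "le (av (a \<triangleright> v \<triangleleft> b)) (rscl (F_norm a) (av (av v \<triangleleft> b)))"
    and av_indep: "F_independent u v \<Longrightarrow> av (u + v) = av u + av v"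
    and av_hereditary:
      "\<lbrakk>u \<in> P; v \<in> P; w \<in> P; av (u - v) = u + v; le w v\<rbrakk> \<Longrightarrow> av (u - w) = u + w"
    and av_sum:
      "\<lbrakk>u \<in> P; v \<in> P; w \<in> P; av (u - v) = u + v; av (u - w) = u + w\<rbrakk>
        \<Longrightarrow> av (u - av (v + w)) = u + av (v + w)"
    and av_diff:
      "\<lbrakk>u \<in> P; v \<in> P; w \<in> P; av (u - v) = u + v; av (u - w) = u + w\<rbrakk>
        \<Longrightarrow> av (u - av (v - w)) = u + av (v - w)"
begin

definition perp :: "'b \<Rightarrow> 'b \<Rightarrow> bool" where
  "perp u v \<longleftrightarrow> av (u - v) = u + v"

end

locale local_F_order_unit_bimodule =
  nondegenerate_ordered_F_bimodule lact ract star P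
  for lact :: "F \<Rightarrow> 'b::ab_group_add \<Rightarrow> 'b" (infixr "\<triangleright>" 75)
    and ract :: "'b \<Rightarrow> F \<Rightarrow> 'b" (infixl "\<triangleleft>" 74)
    and star P +
  fixes e :: 'b
  assumes unit_pos: "e \<in> P"
    and unit_corner: "F_I 1 \<triangleright> e \<triangleleft> F_I 1 = e"
    and unit_dominates: "v = F_I 1 \<triangleright> w \<triangleleft> F_I 1 \<Longrightarrow>
      \<exists>k>0. pair_pos 1 (rscl k e) (rscl k e) + sa_part 1 v \<in> P"
    and proper: "P \<inter> uminus ` P = {0}"
    and archimedean: "\<lbrakk>star v = v; u \<in> P; \<And>k. 0 < k \<Longrightarrow> rscl k u + v \<in> P\<rbrakk> \<Longrightarrow> v \<in> P"
begin

definition nrm :: "'b \<Rightarrow> real" where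
  "nrm v = (let n = elt_order v; e\<^sub>n = corner_unit e n in
     Inf {k. 0 < k \<and> pair_pos n (rscl k e\<^sub>n) (rscl k e\<^sub>n) + sa_part n v \<in> P})"

definition perp_inf :: "'b \<Rightarrow> 'b \<Rightarrow> bool" where
  "perp_inf u v \<longleftrightarrow> (\<forall>k\<^sub>1 k\<^sub>2.
     nrm (rscl k\<^sub>1 u + rscl k\<^sub>2 v) = max (nrm (rscl k\<^sub>1 u)) (nrm (rscl k\<^sub>2 v)))"

definition perp_inf_abs :: "'b \<Rightarrow> 'b \<Rightarrow> bool" where
  "perp_inf_abs u v \<longleftrightarrow>
     (\<forall>u\<^sub>1\<in>P. \<forall>v\<^sub>1\<in>P. le u\<^sub>1 u \<longrightarrow> le v\<^sub>1 v \<longrightarrow> perp_inf u\<^sub>1 v\<^sub>1)"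

end

locale nondegenerate_absolute_order_unital_F_bimodule =
  local_F_order_unit_bimodule lact ract star P e +
  nondegenerate_absolutely_ordered_F_bimodule lact ract star P av
  for lact ract star P e av +
  assumes perp_iff: "u \<in> P \<Longrightarrow> v \<in> P \<Longrightarrow> perp u v \<longleftrightarrow> perp_inf_abs u v"


section \<open>Matrices over a vector space\<close>

definition mat_scale :: "(complex \<Rightarrow> 'v \<Rightarrow> 'v) \<Rightarrow> real \<Rightarrow> 'v mat \<Rightarrow> 'v mat" where
  "mat_scale scale k v = map_mat (scale (complex_of_real k)) v"

definition mat_left :: "(complex \<Rightarrow> 'v::ab_group_add \<Rightarrow> 'v) \<Rightarrow> complex mat \<Rightarrow> 'v mat \<Rightarrow> 'v mat" where
  "mat_left scale \<alpha> v = mat (dim_row \<alpha>) (dim_col v)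
     (\<lambda>(i, j). \<Sum>k<dim_row v. scale (\<alpha> $$ (i, k)) (v $$ (k, j)))"

definition mat_right :: "(complex \<Rightarrow> 'v::ab_group_add \<Rightarrow> 'v) \<Rightarrow> 'v mat \<Rightarrow> complex mat \<Rightarrow> 'v mat" where
  "mat_right scale v \<beta> = mat (dim_row v) (dim_col \<beta>)
     (\<lambda>(i, j). \<Sum>k<dim_col v. scale (\<beta> $$ (k, j)) (v $$ (i, k)))"

definition mat_adj :: "('a \<Rightarrow> 'a) \<Rightarrow> 'a mat \<Rightarrow> 'a mat" where
  "mat_adj s v = map_mat s (transpose_mat v)"

definition mat_sum :: "'v::zero mat \<Rightarrow> 'v mat \<Rightarrow> 'v mat" (infixr "\<oplus>\<^sub>d" 66) where
  "v \<oplus>\<^sub>d w = four_block_mat v (0\<^sub>m (dim_row v) (dim_col w)) (0\<^sub>m (dim_row w) (dim_col v)) w"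

definition unit_mat :: "'v::zero \<Rightarrow> nat \<Rightarrow> 'v mat" where
  "unit_mat e n = mat n n (\<lambda>(i, j). if i = j then e else 0)"

definition vec_l2 :: "complex vec \<Rightarrow> real" where
  "vec_l2 x = L2_set (\<lambda>i. cmod (x $ i)) {..<dim_vec x}"

definition mat_norm :: "complex mat \<Rightarrow> real" where
  "mat_norm \<alpha> = Sup {vec_l2 (\<alpha> *\<^sub>v x) | x. x \<in> carrier_vec (dim_col \<alpha>) \<and> vec_l2 x \<le> 1}"


section \<open>Absolutely ordered spaces\<close>

text \<open>
  Real ordered vector spaces are given by a carrier set \<open>X\<close>, since they are used for spaces of
  self-adjoint matrices of a fixed size. The cone \<open>C\<close> need not be proper.
\<close>

locale real_ordered_vector_space =
  fixes X :: "'x::{plus,minus} set" and zero :: 'x and smul :: "real \<Rightarrow> 'x \<Rightarrow> 'x" and C :: "'x set"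
  assumes zero_closed: "zero \<in> X"
    and add_closed: "x \<in> X \<Longrightarrow> y \<in> X \<Longrightarrow> x + y \<in> X"
    and smul_closed: "x \<in> X \<Longrightarrow> smul k x \<in> X"
    and add_assoc: "x \<in> X \<Longrightarrow> y \<in> X \<Longrightarrow> z \<in> X \<Longrightarrow> (x + y) + z = x + (y + z)"
    and add_comm: "x \<in> X \<Longrightarrow> y \<in> X \<Longrightarrow> x + y = y + x"
    and add_zero: "x \<in> X \<Longrightarrow> x + zero = x"
    and add_neg: "x \<in> X \<Longrightarrow> x + smul (-1) x = zero"
    and diff_eq: "x \<in> X \<Longrightarrow> y \<in> X \<Longrightarrow> x - y = x + smul (-1) y"
    and smul_one: "x \<in> X \<Longrightarrow> smul 1 x = x"
    and smul_smul: "x \<in> X \<Longrightarrow> smul k (smul l x) = smul (k * l) x"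
    and smul_add_right: "x \<in> X \<Longrightarrow> y \<in> X \<Longrightarrow> smul k (x + y) = smul k x + smul k y"
    and smul_add_left: "x \<in> X \<Longrightarrow> smul (k + l) x = smul k x + smul l x"
    and cone_sub: "C \<subseteq> X"
    and cone_zero: "zero \<in> C"
    and cone_add: "x \<in> C \<Longrightarrow> y \<in> C \<Longrightarrow> x + y \<in> C"
    and cone_smul: "x \<in> C \<Longrightarrow> 0 \<le> k \<Longrightarrow> smul k x \<in> C"

locale absolutely_ordered_space = real_ordered_vector_space X zero smul C
  for X :: "'x::{plus,minus} set" and zero smul C +
  fixes av :: "'x \<Rightarrow> 'x"
  assumes av_pos: "v \<in> X \<Longrightarrow> av v \<in> C"
    and av_fix: "v \<in> C \<Longrightarrow> av v = v"
    and av_plus: "v \<in> X \<Longrightarrow> av v + v \<in> C"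
    and av_minus: "v \<in> X \<Longrightarrow> av v - v \<in> C"
    and av_smul: "v \<in> X \<Longrightarrow> av (smul k v) = smul \<bar>k\<bar> (av v)"
    and av_hereditary:
      "\<lbrakk>u \<in> X; v \<in> X; w \<in> C; av (u - v) = u + v; v - w \<in> C\<rbrakk> \<Longrightarrow> av (u - w) = u + w"
    and av_sum:
      "\<lbrakk>u \<in> X; v \<in> X; w \<in> X; av (u - v) = u + v; av (u - w) = u + w\<rbrakk>
        \<Longrightarrow> av (u - av (v + w)) = u + av (v + w)"
    and av_diff:
      "\<lbrakk>u \<in> X; v \<in> X; w \<in> X; av (u - v) = u + v; av (u - w) = u + w\<rbrakk>
        \<Longrightarrow> av (u - av (v - w)) = u + av (v - w)"


section \<open>Absolute matrix order unit spaces\<close>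

locale involutive_space = vector_space scale
  for scale :: "complex \<Rightarrow> 'v::ab_group_add \<Rightarrow> 'v" +
  fixes star :: "'v \<Rightarrow> 'v"
  assumes star_add: "star (v + w) = star v + star w"
    and star_scale: "star (scale \<alpha> v) = scale (cnj \<alpha>) (star v)"
    and star_star: "star (star v) = v"
begin

definition msa :: "nat \<Rightarrow> 'v mat set" where
  "msa n = {v \<in> carrier_mat n n. mat_adj star v = v}"

end

locale matrix_ordered_space = involutive_space scale star
  for scale :: "complex \<Rightarrow> 'v::ab_group_add \<Rightarrow> 'v" and star +
  fixes cone :: "nat \<Rightarrow> 'v mat set"
  assumes matrix_ordered: "0 < n \<Longrightarrow>
      real_ordered_vector_space (msa n) (0\<^sub>m n n) (mat_scale scale) (cone n)"
    and compress: "\<lbrakk>0 < m; 0 < n; v \<in> cone n; \<alpha> \<in> carrier_mat n m\<rbrakk> \<Longrightarrow>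
      mat_left scale (mat_adj cnj \<alpha>) (mat_right scale v \<alpha>) \<in> cone m"

text \<open>The space itself is identified with the \<open>1 \<times> 1\<close> matrices by means of \<open>\<lambda>v. unit_mat v 1\<close>.\<close>

locale matrix_order_unit_space = matrix_ordered_space scale star cone
  for scale :: "complex \<Rightarrow> 'v::ab_group_add \<Rightarrow> 'v" and star cone +
  fixes e :: 'v
  assumes unit_pos: "unit_mat e 1 \<in> cone 1"
    and order_unit: "v \<in> msa 1 \<Longrightarrow>
      \<exists>k>0. mat_scale scale k (unit_mat e 1) + v \<in> cone 1 \<and>
            mat_scale scale k (unit_mat e 1) - v \<in> cone 1"
    and proper: "cone 1 \<inter> uminus ` cone 1 = {0\<^sub>m 1 1}"
    and archimedean: "\<lbrakk>0 < n; v \<in> msa n; u \<in> cone n;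
      \<And>k. 0 < k \<Longrightarrow> mat_scale scale k u + v \<in> cone n\<rbrakk> \<Longrightarrow> v \<in> cone n"
begin

definition nrm :: "nat \<Rightarrow> 'v mat \<Rightarrow> real" where
  "nrm n v = Inf {k. 0 < k \<and>
     four_block_mat (mat_scale scale k (unit_mat e n)) v
       (mat_adj star v) (mat_scale scale k (unit_mat e n)) \<in> cone (2 * n)}"

definition perp_inf :: "nat \<Rightarrow> 'v mat \<Rightarrow> 'v mat \<Rightarrow> bool" where
  "perp_inf n u v \<longleftrightarrow> (\<forall>k\<^sub>1 k\<^sub>2. nrm n (mat_scale scale k\<^sub>1 u + mat_scale scale k\<^sub>2 v) =
     max (nrm n (mat_scale scale k\<^sub>1 u)) (nrm n (mat_scale scale k\<^sub>2 v)))"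

definition perp_inf_abs :: "nat \<Rightarrow> 'v mat \<Rightarrow> 'v mat \<Rightarrow> bool" where
  "perp_inf_abs n u v \<longleftrightarrow> (\<forall>u\<^sub>1\<in>cone n. \<forall>v\<^sub>1\<in>cone n.
     u - u\<^sub>1 \<in> cone n \<longrightarrow> v - v\<^sub>1 \<in> cone n \<longrightarrow> perp_inf n u\<^sub>1 v\<^sub>1)"

end

text \<open>\<open>mav m n\<close> is the absolute value on \<open>m \<times> n\<close> matrices; its values are \<open>n \<times> n\<close> matrices.\<close>

locale absolutely_matrix_ordered_space = matrix_ordered_space scale star cone
  for scale :: "complex \<Rightarrow> 'v::ab_group_add \<Rightarrow> 'v" and star cone +
  fixes mav :: "nat \<Rightarrow> nat \<Rightarrow> 'v mat \<Rightarrow> 'v mat"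
  assumes mav_pos: "\<lbrakk>0 < m; 0 < n; v \<in> carrier_mat m n\<rbrakk> \<Longrightarrow> mav m n v \<in> cone n"
    and mav_square: "0 < n \<Longrightarrow>
      absolutely_ordered_space (msa n) (0\<^sub>m n n) (mat_scale scale) (cone n) (mav n n)"
    and mav_mult: "\<lbrakk>0 < m; 0 < n; 0 < r; 0 < s;
        v \<in> carrier_mat m n; \<alpha> \<in> carrier_mat r m; \<beta> \<in> carrier_mat n s\<rbrakk> \<Longrightarrow>
      mat_scale scale (mat_norm \<alpha>) (mav n s (mat_right scale (mav m n v) \<beta>))
        - mav r s (mat_right scale (mat_left scale \<alpha> v) \<beta>) \<in> cone s"
    and mav_sum: "\<lbrakk>0 < m; 0 < n; 0 < r; 0 < s; v \<in> carrier_mat m n; w \<in> carrier_mat r s\<rbrakk> \<Longrightarrow>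
      mav (m + r) (n + s) (v \<oplus>\<^sub>d w) = mav m n v \<oplus>\<^sub>d mav r s w"
begin

definition perp :: "nat \<Rightarrow> 'v mat \<Rightarrow> 'v mat \<Rightarrow> bool" where
  "perp n u v \<longleftrightarrow> mav n n (u - v) = u + v"

end

locale absolute_matrix_order_unit_space =
  matrix_order_unit_space scale star cone e +
  absolutely_matrix_ordered_space scale star cone mav
  for scale star cone e mav +
  assumes perp_iff:
    "\<lbrakk>0 < n; u \<in> cone n; v \<in> cone n\<rbrakk> \<Longrightarrow> perp n u v \<longleftrightarrow> perp_inf_abs n u v"


section \<open>The matricial inductive limit\<close>

text \<open>
  The limit of the spaces of \<open>n \<times> n\<close> matrices over \<open>'v\<close> is the type \<open>'v finmat\<close>.
\<close>

definition lim_map :: "nat \<Rightarrow> 'v::ab_group_add mat \<Rightarrow> 'v finmat" where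
  "lim_map n v = (\<Sum>i<n. \<Sum>j<n. Poly_Mapping.single (i, j) (v $$ (i, j)))"

definition lim_lact :: "(complex \<Rightarrow> 'v::ab_group_add \<Rightarrow> 'v) \<Rightarrow> F \<Rightarrow> 'v finmat \<Rightarrow> 'v finmat" where
  "lim_lact scale a v = fin_mult scale a v"

definition lim_ract :: "(complex \<Rightarrow> 'v::ab_group_add \<Rightarrow> 'v) \<Rightarrow> 'v finmat \<Rightarrow> F \<Rightarrow> 'v finmat" where
  "lim_ract scale v a = fin_mult (\<lambda>x c. scale c x) v a"

definition lim_star :: "('v::ab_group_add \<Rightarrow> 'v) \<Rightarrow> 'v finmat \<Rightarrow> 'v finmat" where
  "lim_star star v = fin_adj star v"

definition lim_cone :: "(nat \<Rightarrow> 'v::ab_group_add mat set) \<Rightarrow> 'v finmat set" where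
  "lim_cone cone = (\<Union>n\<in>{0<..}. lim_map n ` cone n)"

definition lim_abs ::
    "(complex \<Rightarrow> 'v::ab_group_add \<Rightarrow> 'v) \<Rightarrow> (nat \<Rightarrow> nat \<Rightarrow> 'v mat \<Rightarrow> 'v mat) \<Rightarrow> 'v finmat \<Rightarrow> 'v finmat"
  where
  "lim_abs scale mav v =
     (let n = F_bimodule.elt_order (lim_lact scale) (lim_ract scale) v
      in lim_map n (mav n n (inv_into (carrier_mat n n) (lim_map n) v)))"

end

theory Submission
  imports Defs "HOL-Library.Infinite_Set"
begin

text \<open>
  An element of the limit lives in all sufficiently large corners, and every axiom involves only
  finitely many elements; so it can be checked in one corner, once positivity, absolute value and
  norm are known not to depend on the corner. For the absolute value this is
  \<open>|v \<oplus> 0| = |v| \<oplus> 0\<close>; for the norm it follows by compressing, respectively enlarging by a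
  multiple of the order unit. The remaining point is invariance under permutations: both
  \<open>|W v| \<le> |v|\<close> and the converse follow from the multiplicative axiom, and properness gives
  \<open>|W v| = |v|\<close> and \<open>|W v W| = W |v| W\<close>. Applied to exchanges of coordinates this yields the block
  positivity of \<open>v\<close>, \<open>|v\<^sup>*|\<close>, \<open>|v|\<close> (from \<open>v\<^sup>* \<oplus> v\<close>) and additivity on independent elements
  (from \<open>u \<oplus> v\<close>).
\<close>

section \<open>Finitely supported matrices\<close>

text \<open>Three features of the hypotheses shape the argument. The orders of u, v and u + v may
  all differ, so \<open>lim_abs\<close> and \<open>nrm\<close> take their values in different sizes;
  freedom in the choice of the size is what makes these values comparable. Properness is assumed for
  the 1 x 1 cone only, while antisymmetry is needed in every size; compression to a single entry and
  polarization supply it. The multiplicative axiom bounds |a v b| by | |v| b |, again the absolute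
  value of an element that need not be positive; for a permutation b = W it is evaluated by first
  multiplying by W on the left, since W |v| W is positive. All permutations used are involutions:
  then W is its own adjoint and, inside the corner, its own inverse, so one inequality applied to v
  and to its image gives equality. Independent elements may interleave within one corner; they turn
  into a block sum only after a permutation, and this can be undone on |u| + |v| only if |u| and |v|
  keep the supports of u and v.\<close>

definition supported :: "nat \<Rightarrow> 'a::zero finmat \<Rightarrow> bool" where
  "supported n x \<longleftrightarrow> (\<forall>i j. Poly_Mapping.lookup x (i, j) \<noteq> 0 \<longrightarrow> i < n \<and> j < n)"

text \<open>An explicit inverse of \<open>lim_map n\<close> on its range, to be used in place of the
  \<open>inv_into\<close> in the definition of \<open>lim_abs\<close>.\<close>

definition corner :: "nat \<Rightarrow> 'a::zero finmat \<Rightarrow> 'a mat" where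
  "corner n x = mat n n (Poly_Mapping.lookup x)"

text \<open>
  Multiplication by \<open>reindex_mat A f\<close> from the right moves column \<open>f j\<close> to column \<open>j\<close>, for
  \<open>j \<in> A\<close>, and clears the other columns.
\<close>

definition reindex_mat :: "nat set \<Rightarrow> (nat \<Rightarrow> nat) \<Rightarrow> F" where
  "reindex_mat A f = (\<Sum>i\<in>A. F_unit (f i) i)"

lemma finmat_eqI:
  assumes "\<And>i j. Poly_Mapping.lookup x (i, j) = Poly_Mapping.lookup y (i, j)"
  shows "x = y"
  by (rule poly_mapping_eqI) (auto simp: assms)

lemma supportedD: "supported n x \<Longrightarrow> n \<le> i \<or> n \<le> j \<Longrightarrow> Poly_Mapping.lookup x (i, j) = 0"
  unfolding supported_def by (meson leD)

lemma supportedI: "(\<And>i j. n \<le> i \<or> n \<le> j \<Longrightarrow> Poly_Mapping.lookup x (i, j) = 0) \<Longrightarrow> supported n x"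
  unfolding supported_def by (meson linorder_not_less)

lemma supported_mono: "supported m x \<Longrightarrow> m \<le> n \<Longrightarrow> supported n x"
  unfolding supported_def by (meson order_less_le_trans)

lemma ex_supported: "\<exists>n>0. supported n x"
proof -
  have fin: "finite (Poly_Mapping.keys x)" by simp
  obtain n where n: "\<forall>k\<in>fst ` Poly_Mapping.keys x \<union> snd ` Poly_Mapping.keys x. k < n"
    using finite_nat_set_iff_bounded[of "fst ` Poly_Mapping.keys x \<union> snd ` Poly_Mapping.keys x"] fin
    by auto
  have "supported n x"
    unfolding supported_def
  proof (intro allI impI)
    fix i j assume "Poly_Mapping.lookup x (i, j) \<noteq> 0"
    then have "(i, j) \<in> Poly_Mapping.keys x" by (simp add: in_keys_iff)
    then have "i \<in> fst ` Poly_Mapping.keys x" "j \<in> snd ` Poly_Mapping.keys x" by force+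
    then show "i < n \<and> j < n" using n by blast
  qed
  \<comment> \<open>The successor makes the size positive, as orders and cones require, even when x
    = 0.\<close>
  then have "supported (Suc n) x" by (rule supported_mono) simp
  then show ?thesis by blast
qed

text \<open>The lower bound k allows a common size to be chosen in stages, which is how elements of
  different types, scalar matrices and elements of the limit, are placed in one corner.\<close>

lemma ex_supported_ge:
  obtains n where "k \<le> n" "0 < n" "supported n x"
proof -
  obtain m where "0 < m" "supported m x" using ex_supported by blast
  then show ?thesis using that[of "max k m"] supported_mono[of m x "max k m"] by auto
qed

lemma ex_supported2:
  obtains n where "k \<le> n" "0 < n" "supported n x" "supported n y"
proof -
  obtain m where m: "k \<le> m" "0 < m" "supported m x" using ex_supported_ge by blast
  obtain n where n: "m \<le> n" "0 < n" "supported n y" using ex_supported_ge by blast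
  show ?thesis
    by (rule that[OF order_trans[OF m(1) n(1)] n(2) supported_mono[OF m(3) n(1)] n(3)])
qed

lemma ex_supported3:
  obtains n where "k \<le> n" "0 < n" "supported n x" "supported n y" "supported n z"
proof -
  obtain m where m: "k \<le> m" "0 < m" "supported m x" using ex_supported_ge by blast
  obtain n where n: "m \<le> n" "0 < n" "supported n y" "supported n z" using ex_supported2 by blast
  show ?thesis
    by (rule that[OF order_trans[OF m(1) n(1)] n(2) supported_mono[OF m(3) n(1)] n(3,4)])
qed

section \<open>Passage between the limit and matrices of a fixed size\<close>

lemma corner_carrier [simp]: "corner n x \<in> carrier_mat n n"
  by (simp add: corner_def)

lemma corner_dim [simp]: "dim_row (corner n x) = n" "dim_col (corner n x) = n"
  by (simp_all add: corner_def)

lemma corner_index [simp]: "i < n \<Longrightarrow> j < n \<Longrightarrow> corner n x $$ (i, j) = Poly_Mapping.lookup x (i, j)"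
  by (simp add: corner_def)

lemma lookup_lim_map [simp]:
  "Poly_Mapping.lookup (lim_map n v) (i, j) = (if i < n \<and> j < n then v $$ (i, j) else 0)"
proof -
  have "Poly_Mapping.lookup (lim_map n v) (i, j)
      = (\<Sum>i'<n. \<Sum>j'<n. if i = i' then (if j = j' then v $$ (i', j') else 0) else 0)"
    unfolding lim_map_def lookup_sum
    by (intro sum.cong refl) (auto simp: lookup_single when_def)
  also have "\<dots> = (\<Sum>i'<n. if i = i' then (\<Sum>j'<n. if j = j' then v $$ (i', j') else 0) else 0)"
    by (intro sum.cong refl) auto
  also have "\<dots> = (if i < n \<and> j < n then v $$ (i, j) else 0)"
    by simp
  finally show ?thesis .
qed

lemma supported_lim_map [simp]: "supported n (lim_map n v)"
  by (rule supportedI) auto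

lemma lim_map_corner: "supported n (x :: 'a::ab_group_add finmat) \<Longrightarrow> lim_map n (corner n x) = x"
  by (rule finmat_eqI) (auto simp: supportedD)

lemma corner_lim_map: "v \<in> carrier_mat n n \<Longrightarrow> corner n (lim_map n v) = v"
  by (rule eq_matI) auto

lemma inv_lim_map:
  "supported n (x :: 'a::ab_group_add finmat)
    \<Longrightarrow> inv_into (carrier_mat n n) (lim_map n) x = corner n x"
proof -
  assume x: "supported n x"
  have "inj_on (lim_map n) (carrier_mat n n)"
    by (rule inj_on_inverseI[where g = "corner n"]) (rule corner_lim_map)
  then have "inv_into (carrier_mat n n) (lim_map n) (lim_map n (corner n x)) = corner n x"
    by (rule inv_into_f_f) simp
  then show ?thesis by (simp add: lim_map_corner x)
qed

lemma corner_inj: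
  "supported n (x :: 'a::ab_group_add finmat) \<Longrightarrow> supported n y \<Longrightarrow> corner n x = corner n y \<Longrightarrow> x = y"
proof -
  assume x: "supported n x" and y: "supported n y" and eq: "corner n x = corner n y"
  have "lim_map n (corner n x) = lim_map n (corner n y)" by (simp only: eq)
  then show ?thesis by (simp only: lim_map_corner[OF x] lim_map_corner[OF y])
qed

lemma corner_add [simp]: "corner n (x + y) = corner n x + corner n (y :: 'a::ab_group_add finmat)"
  by (rule eq_matI) (auto simp: lookup_add)

lemma corner_minus [simp]: "corner n (x - y) = corner n x - corner n (y :: 'a::ab_group_add finmat)"
  by (rule eq_matI) (auto simp: lookup_minus)

lemma corner_uminus [simp]: "corner n (- x) = - corner n (x :: 'a::ab_group_add finmat)"
  by (rule eq_matI) auto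

lemma corner_zero [simp]: "corner n 0 = 0\<^sub>m n n"
  by (rule eq_matI) auto

lemma supported_add: "supported n x \<Longrightarrow> supported n y \<Longrightarrow> supported n (x + y :: 'a::ab_group_add finmat)"
  by (rule supportedI) (auto simp: lookup_add supportedD)

lemma supported_minus: "supported n x \<Longrightarrow> supported n y \<Longrightarrow> supported n (x - y :: 'a::ab_group_add finmat)"
  by (rule supportedI) (auto simp: lookup_minus supportedD)

lemma supported_zero [simp]: "supported n 0"
  by (rule supportedI) auto

section \<open>Entries of products, adjoints and reindexing matrices\<close>

text \<open>The support of one factor already cuts the sum off at n, so the other factor may reach
  beyond that size.\<close>

lemma lookup_fin_mult:
  assumes l: "\<And>y. f 0 y = 0" and r: "\<And>x. f x 0 = 0" and "supported n a \<or> supported n b"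
  shows "Poly_Mapping.lookup (fin_mult f a b) (i, j)
    = (\<Sum>k<n. f (Poly_Mapping.lookup a (i, k)) (Poly_Mapping.lookup b (k, j)))"
  unfolding fin_mult.rep_eq prod.case
proof (rule sum.mono_neutral_left)
  show "{k. Poly_Mapping.lookup a (i, k) \<noteq> 0 \<and> Poly_Mapping.lookup b (k, j) \<noteq> 0} \<subseteq> {..<n}"
    using assms(3) unfolding supported_def by auto
qed (auto simp: l r)

lemma supported_fin_mult:
  assumes "\<And>y. f 0 y = 0" "\<And>x. f x 0 = 0" "supported n a" "supported n b"
  shows "supported n (fin_mult f a b)"
  by (rule supportedI) (use assms in \<open>auto simp: lookup_fin_mult[where n = n] supportedD\<close>)

lemma lookup_fin_adj:
  assumes "s 0 = 0"
  shows "Poly_Mapping.lookup (fin_adj s a) (i, j) = s (Poly_Mapping.lookup a (j, i))"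
  unfolding fin_adj_def
  by (auto simp: Poly_Mapping.map.rep_eq map_key.rep_eq when_def assms)

lemma lookup_F_adj [simp]: "Poly_Mapping.lookup (F_adj a) (i, j) = cnj (Poly_Mapping.lookup a (j, i))"
  by (simp add: F_adj_def lookup_fin_adj)

lemma supported_F_adj: "supported n a \<Longrightarrow> supported n (F_adj a)"
  by (rule supportedI) (auto simp: supportedD)

lemma F_adj_adj [simp]: "F_adj (F_adj a) = a"
  by (rule finmat_eqI) simp

lemma corner_F_adj: "corner n (F_adj a) = mat_adj cnj (corner n a)"
  by (rule eq_matI) (auto simp: mat_adj_def)

lemma lookup_F_scale [simp]:
  "Poly_Mapping.lookup (F_scale c a) (i, j) = c * Poly_Mapping.lookup a (i, j)"
  by (auto simp: F_scale_def Poly_Mapping.map.rep_eq when_def)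

lemma lookup_reindex_mat:
  assumes "finite A"
  shows "Poly_Mapping.lookup (reindex_mat A f) (k, i) = (if i \<in> A \<and> k = f i then 1 else 0)"
proof -
  have "Poly_Mapping.lookup (reindex_mat A f) (k, i)
      = (\<Sum>i'\<in>A. if i = i' then (if k = f i' then 1 else 0) else 0)"
    unfolding reindex_mat_def lookup_sum F_unit_def
    by (intro sum.cong refl) (auto simp: lookup_single when_def)
  also have "\<dots> = (if i \<in> A \<and> k = f i then 1 else 0)"
    by (subst sum.delta'[OF assms]) auto
  finally show ?thesis .
qed

text \<open>Diagonal projections, \<open>F_I\<close>, \<open>F_J\<close> and matrix units are all
  reindexing matrices, so a single computation of entries covers the actions of all of them.\<close>

lemma F_diag_reindex: "F_diag S = reindex_mat S id"
  by (simp add: F_diag_def reindex_mat_def)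

lemma F_I_reindex: "F_I n = reindex_mat {..<n} id"
  by (simp add: F_I_def F_diag_reindex)

lemma F_J_reindex: "F_J n = reindex_mat {n..<2 * n} (\<lambda>j. j - n)"
  unfolding F_J_def reindex_mat_def
  by (rule sum.reindex_bij_witness[of _ "\<lambda>j. j - n" "\<lambda>i. n + i"]) auto

lemma F_unit_reindex: "F_unit i j = reindex_mat {j} (\<lambda>_. i)"
  by (simp add: reindex_mat_def)

lemma F_unit_adj: "F_unit i j = F_adj (F_unit j i)"
  by (rule finmat_eqI) (auto simp: F_unit_reindex lookup_reindex_mat)

lemma F_adj_diag: "finite S \<Longrightarrow> F_adj (F_diag S) = F_diag S"
  by (rule finmat_eqI) (auto simp: F_diag_reindex lookup_reindex_mat)

lemma F_adj_I: "F_adj (F_I n) = F_I n"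
  by (simp add: F_I_def F_adj_diag)

lemma F_adj_involution:
  assumes "\<And>i. p (p i) = i" "\<And>i. i < n \<Longrightarrow> p i < n"
  shows "F_adj (reindex_mat {..<n} p) = reindex_mat {..<n} p"
  by (rule finmat_eqI) (use assms in \<open>auto simp: lookup_reindex_mat\<close>)

lemma supported_reindex_mat:
  "A \<subseteq> {..<n} \<Longrightarrow> f ` A \<subseteq> {..<n} \<Longrightarrow> supported n (reindex_mat A f)"
proof -
  assume A: "A \<subseteq> {..<n}" and f: "f ` A \<subseteq> {..<n}"
  have "finite A" using finite_subset[OF A] by simp
  then show ?thesis
    by (intro supportedI) (use A f in \<open>fastforce simp: lookup_reindex_mat\<close>)
qed


section \<open>The operator norm\<close>

lemma L2_set_le_one_iff: "L2_set f A \<le> 1 \<longleftrightarrow> (\<Sum>i\<in>A. (f i)\<^sup>2) \<le> 1"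
  by (simp add: L2_set_def)

text \<open>The two suprema are taken over the same set: truncating a sequence to n coordinates
  keeps its image and does not increase its norm, and conversely a vector is extended by zeros.
  Boundedness of the set is therefore never at issue.\<close>

lemma F_norm_corner:
  assumes a: "supported n a"
  shows "F_norm a = mat_norm (corner n a)"
proof -
  let ?l = "Poly_Mapping.lookup a"
  let ?A = "{sqrt (suminf (\<lambda>i. (cmod (suminf (\<lambda>j. ?l (i, j) * x j)))\<^sup>2)) |
      x :: nat \<Rightarrow> complex.
      summable (\<lambda>j. (cmod (x j))\<^sup>2) \<and> suminf (\<lambda>j. (cmod (x j))\<^sup>2) \<le> 1}"
  let ?B = "{vec_l2 (corner n a *\<^sub>v y) | y. y \<in> carrier_vec (dim_col (corner n a)) \<and> vec_l2 y \<le> 1}"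
  have eq: "sqrt (suminf (\<lambda>i. (cmod (suminf (\<lambda>j. ?l (i, j) * x j)))\<^sup>2))
      = vec_l2 (corner n a *\<^sub>v vec n x)" for x :: "nat \<Rightarrow> complex"
  proof -
    have row: "suminf (\<lambda>j. ?l (i, j) * x j) = (\<Sum>j<n. ?l (i, j) * x j)" for i
      by (rule suminf_finite) (auto simp: supportedD[OF a])
    have "suminf (\<lambda>i. (cmod (suminf (\<lambda>j. ?l (i, j) * x j)))\<^sup>2)
        = (\<Sum>i<n. (cmod (\<Sum>j<n. ?l (i, j) * x j))\<^sup>2)"
      unfolding row by (rule suminf_finite) (auto simp: supportedD[OF a])
    also have "\<dots> = (\<Sum>i<n. (cmod ((corner n a *\<^sub>v vec n x) $ i))\<^sup>2)"
      by (intro sum.cong refl)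
        (simp add: scalar_prod_def lessThan_atLeast0)
    finally show ?thesis by (simp add: vec_l2_def L2_set_def)
  qed
  have "?A = ?B"
  proof (intro equalityI subsetI)
    fix r assume "r \<in> ?A"
    then obtain x :: "nat \<Rightarrow> complex" where x: "summable (\<lambda>j. (cmod (x j))\<^sup>2)"
      "suminf (\<lambda>j. (cmod (x j))\<^sup>2) \<le> 1" and r: "r = vec_l2 (corner n a *\<^sub>v vec n x)"
      unfolding eq by blast
    have "(\<Sum>j<n. (cmod (x j))\<^sup>2) \<le> 1"
      using sum_le_suminf[OF x(1), of "{..<n}"] x(2) by simp
    then have "vec_l2 (vec n x) \<le> 1"
      by (simp add: vec_l2_def L2_set_le_one_iff)
    then show "r \<in> ?B" using r by auto
  next
    fix r assume "r \<in> ?B"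
    then obtain y where y: "y \<in> carrier_vec n" "vec_l2 y \<le> 1" and r: "r = vec_l2 (corner n a *\<^sub>v y)"
      by auto
    define x where "x j = (if j < n then y $ j else 0)" for j
    have xy: "vec n x = y" using y(1) by (intro eq_vecI) (auto simp: x_def)
    have fin: "finite {..<n}" "\<And>j. j \<notin> {..<n} \<Longrightarrow> (cmod (x j))\<^sup>2 = 0" by (auto simp: x_def)
    have "suminf (\<lambda>j. (cmod (x j))\<^sup>2) = (\<Sum>j<n. (cmod (x j))\<^sup>2)"
      by (rule suminf_finite[OF fin])
    also have "\<dots> \<le> 1"
      using y by (simp add: vec_l2_def L2_set_le_one_iff x_def)
    finally have "suminf (\<lambda>j. (cmod (x j))\<^sup>2) \<le> 1" .
    moreover have "summable (\<lambda>j. (cmod (x j))\<^sup>2)" by (rule summable_finite[OF fin])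
    ultimately show "r \<in> ?A" unfolding eq using r xy by blast
  qed
  then show ?thesis unfolding F_norm_def mat_norm_def by simp
qed

lemma mat_norm_le_one:
  assumes "\<And>y. y \<in> carrier_vec (dim_col \<alpha>) \<Longrightarrow> vec_l2 (\<alpha> *\<^sub>v y) \<le> vec_l2 y"
  shows "mat_norm \<alpha> \<le> 1"
  unfolding mat_norm_def
proof (rule cSup_least)
  have "vec_l2 (0\<^sub>v (dim_col \<alpha>)) \<le> 1" by (simp add: vec_l2_def L2_set_def)
  then show "{vec_l2 (\<alpha> *\<^sub>v x) |x. x \<in> carrier_vec (dim_col \<alpha>) \<and> vec_l2 x \<le> 1} \<noteq> {}"
    by (metis (mono_tags, lifting) empty_iff mem_Collect_eq zero_carrier_vec)
qed (use assms order_trans in blast)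

text \<open>A permutation matrix only rearranges the terms of the Euclidean norm. The bound 1 is
  what lets the factor in the multiplicative axiom be dropped.\<close>

lemma F_norm_involution:
  assumes p: "\<And>i. p (p i) = i" "\<And>i. i < n \<Longrightarrow> p i < n"
  shows "F_norm (reindex_mat {..<n} p) \<le> 1"
proof -
  let ?W = "reindex_mat {..<n} p"
  have "supported n ?W" by (rule supported_reindex_mat) (use p in auto)
  moreover have "mat_norm (corner n ?W) \<le> 1"
  proof (rule mat_norm_le_one)
    fix y :: "complex vec" assume "y \<in> carrier_vec (dim_col (corner n ?W))"
    then have y: "y \<in> carrier_vec n" by simp
    have ent: "(corner n ?W *\<^sub>v y) $ i = y $ p i" if i: "i < n" for i
    proof -
      have "(corner n ?W *\<^sub>v y) $ i = (\<Sum>k<n. (if i = p k then 1 else 0) * y $ k)"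
        using i y by (auto simp: scalar_prod_def lessThan_atLeast0 lookup_reindex_mat intro!: sum.cong)
      also have "\<dots> = (\<Sum>k<n. if p i = k then y $ k else 0)"
        by (intro sum.cong refl) (use p in auto)
      also have "\<dots> = y $ p i" using p(2)[OF i] by simp
      finally show ?thesis .
    qed
    have "(\<Sum>i<n. (cmod (y $ p i))\<^sup>2) = (\<Sum>i<n. (cmod (y $ i))\<^sup>2)"
      by (rule sum.reindex_bij_witness[of _ p p]) (use p in auto)
    then show "vec_l2 (corner n ?W *\<^sub>v y) \<le> vec_l2 y"
      using y by (simp add: vec_l2_def L2_set_def ent del: index_mult_mat_vec)
  qed
  ultimately show ?thesis by (simp add: F_norm_corner)
qed

lemma F_norm_I: "F_norm (F_I n) \<le> 1"
  unfolding F_I_reindex by (rule F_norm_involution) auto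

section \<open>The bimodule structure of the limit\<close>

context involutive_space
begin

abbreviation lact :: "F \<Rightarrow> 'v finmat \<Rightarrow> 'v finmat" (infixr "\<triangleright>" 75) where
  "lact \<equiv> lim_lact scale"

abbreviation ract :: "'v finmat \<Rightarrow> F \<Rightarrow> 'v finmat" (infixl "\<triangleleft>" 74) where
  "ract \<equiv> lim_ract scale"

lemma star_zero [simp]: "star 0 = 0"
  using star_add[of 0 0] by simp

lemma star_sum: "star (sum f A) = (\<Sum>i\<in>A. star (f i))"
  by (induction A rule: infinite_finite_induct) (auto simp: star_add)

lemma lookup_lact:
  "supported n a \<or> supported n v \<Longrightarrow> Poly_Mapping.lookup (a \<triangleright> v) (i, j)
    = (\<Sum>k<n. scale (Poly_Mapping.lookup a (i, k)) (Poly_Mapping.lookup v (k, j)))"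
  unfolding lim_lact_def by (rule lookup_fin_mult) auto

lemma lookup_ract:
  "supported n v \<or> supported n a \<Longrightarrow> Poly_Mapping.lookup (v \<triangleleft> a) (i, j)
    = (\<Sum>k<n. scale (Poly_Mapping.lookup a (k, j)) (Poly_Mapping.lookup v (i, k)))"
  unfolding lim_ract_def by (rule lookup_fin_mult) auto

lemma lookup_F_mult:
  "supported n a \<or> supported n b \<Longrightarrow> Poly_Mapping.lookup (F_mult a b) (i, j)
    = (\<Sum>k<n. Poly_Mapping.lookup a (i, k) * Poly_Mapping.lookup b (k, j))"
  unfolding F_mult_def by (rule lookup_fin_mult) auto

lemma supported_lact: "supported n a \<Longrightarrow> supported n v \<Longrightarrow> supported n (a \<triangleright> v)"
  unfolding lim_lact_def by (rule supported_fin_mult) auto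

lemma supported_ract: "supported n a \<Longrightarrow> supported n v \<Longrightarrow> supported n (v \<triangleleft> a)"
  unfolding lim_ract_def by (rule supported_fin_mult) auto

lemma lookup_star [simp]:
  "Poly_Mapping.lookup (lim_star star v) (i, j) = star (Poly_Mapping.lookup v (j, i))"
  by (simp add: lim_star_def lookup_fin_adj)

lemma supported_star: "supported n v \<Longrightarrow> supported n (lim_star star v)"
  by (rule supportedI) (auto simp: supportedD)

lemma corner_star: "corner n (lim_star star v) = mat_adj star (corner n v)"
  by (rule eq_matI) (auto simp: mat_adj_def)

lemma corner_lact:
  "supported n v \<Longrightarrow> corner n (a \<triangleright> v) = mat_left scale (corner n a) (corner n v)"
  by (rule eq_matI) (auto simp: mat_left_def lookup_lact[of n] intro!: sum.cong)

lemma corner_ract: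
  "supported n v \<Longrightarrow> corner n (v \<triangleleft> a) = mat_right scale (corner n v) (corner n a)"
  by (rule eq_matI) (auto simp: mat_right_def lookup_ract[of n] intro!: sum.cong)

text \<open>Once all elements sit in one size N, every law is an entrywise identity of finite sums;
  the associativity laws amount to interchanging two summations.\<close>

lemma lim_bimodule: "star_F_bimodule lact ract (lim_star star)"
proof
  fix a b :: F and v w :: "'v finmat" and \<alpha> :: complex
  obtain n where a: "supported n a" and b: "supported n b"
    using ex_supported2[of 0 a b] by blast
  obtain N where "n \<le> N" and v: "supported N v" and w: "supported N w"
    using ex_supported2[of n v w] by blast
  with a b have a: "supported N a" and b: "supported N b" by (auto intro: supported_mono)
  have av: "supported N (a \<triangleright> v)" and bv: "supported N (b \<triangleright> v)" and va: "supported N (v \<triangleleft> a)"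
    and vb: "supported N (v \<triangleleft> b)"
    using a b v by (auto intro: supported_lact supported_ract)
  note look = lookup_lact[where n = N] lookup_ract[where n = N] lookup_F_mult[where n = N] lookup_add
  show "(a + b) \<triangleright> v = (a \<triangleright> v) + (b \<triangleright> v)"
    by (rule finmat_eqI) (simp add: look a b v scale_left_distrib sum.distrib)
  show "a \<triangleright> (v + w) = (a \<triangleright> v) + (a \<triangleright> w)"
    by (rule finmat_eqI) (simp add: look a v w scale_right_distrib sum.distrib)
  show "(v + w) \<triangleleft> a = (v \<triangleleft> a) + (w \<triangleleft> a)"
    by (rule finmat_eqI) (simp add: look a v w scale_right_distrib sum.distrib)
  show "v \<triangleleft> (a + b) = (v \<triangleleft> a) + (v \<triangleleft> b)"
    by (rule finmat_eqI) (simp add: look a b v scale_left_distrib sum.distrib)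
  show "F_mult a b \<triangleright> v = a \<triangleright> (b \<triangleright> v)"
    by (rule finmat_eqI, simp add: look a b v bv scale_sum_left scale_sum_right)
      (subst sum.swap, simp)
  show "v \<triangleleft> F_mult a b = (v \<triangleleft> a) \<triangleleft> b"
    by (rule finmat_eqI, simp add: look a b v va scale_sum_left scale_sum_right)
      (subst sum.swap, simp add: mult.commute)
  show "(a \<triangleright> v) \<triangleleft> b = a \<triangleright> (v \<triangleleft> b)"
    by (rule finmat_eqI, simp add: look a b v av vb scale_sum_right)
      (subst sum.swap, simp add: mult.commute)
  show "(F_scale \<alpha> a \<triangleright> v) \<triangleleft> b = (a \<triangleright> v) \<triangleleft> F_scale \<alpha> b"
  proof -
    have "supported N (F_scale \<alpha> a)" by (rule supportedI) (auto simp: supportedD[OF a])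
    then have "supported N (F_scale \<alpha> a \<triangleright> v)" using v by (rule supported_lact)
    then show ?thesis
      by (intro finmat_eqI) (simp add: look a b v av scale_sum_right ac_simps)
  qed
  show "lim_star star (v + w) = lim_star star v + lim_star star w"
    by (rule finmat_eqI) (simp add: lookup_add star_add)
  show "lim_star star (a \<triangleright> v) = lim_star star v \<triangleleft> F_adj a"
    by (rule finmat_eqI)
      (simp add: look a v supported_star supported_F_adj star_sum star_scale)
  show "lim_star star (v \<triangleleft> a) = F_adj a \<triangleright> lim_star star v"
    by (rule finmat_eqI)
      (simp add: look a v supported_star supported_F_adj star_sum star_scale)
  show "lim_star star (lim_star star v) = v"
    by (rule finmat_eqI) (simp add: star_star)
qed

sublocale lim: star_F_bimodule lact ract "lim_star star"
  by (rule lim_bimodule)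

section \<open>Entries of compressions, shifts and block elements\<close>

lemma lookup_ract_reindex:
  assumes "finite A"
  shows "Poly_Mapping.lookup (v \<triangleleft> reindex_mat A f) (i, j)
    = (if j \<in> A then Poly_Mapping.lookup v (i, f j) else 0)"
proof -
  obtain n where v: "supported n v" using ex_supported by blast
  have "Poly_Mapping.lookup (v \<triangleleft> reindex_mat A f) (i, j)
      = (\<Sum>k<n. if f j = k then (if j \<in> A then Poly_Mapping.lookup v (i, k) else 0) else 0)"
    unfolding lookup_ract[OF disjI1[OF v]] lookup_reindex_mat[OF assms]
    by (intro sum.cong refl) auto
  also have "\<dots> = (if j \<in> A then Poly_Mapping.lookup v (i, f j) else 0)"
    by (simp add: supportedD[OF v])
  finally show ?thesis .
qed

text \<open>Obtained from the right action by taking adjoints, which explains the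
  \<open>F_adj\<close> in the statement.\<close>

lemma lookup_lact_reindex:
  assumes "finite A"
  shows "Poly_Mapping.lookup (F_adj (reindex_mat A f) \<triangleright> v) (i, j)
    = (if i \<in> A then Poly_Mapping.lookup v (f i, j) else 0)"
proof -
  have "Poly_Mapping.lookup (F_adj (reindex_mat A f) \<triangleright> v) (i, j)
      = star (Poly_Mapping.lookup (lim_star star v \<triangleleft> reindex_mat A f) (j, i))"
    by (metis F_adj_adj lim.star_lact lim.star_star lookup_star)
  then show ?thesis by (simp add: lookup_ract_reindex[OF assms] star_star)
qed

lemma lookup_compress_diag:
  assumes "finite S"
  shows "Poly_Mapping.lookup (F_diag S \<triangleright> v \<triangleleft> F_diag S) (i, j)
    = (if i \<in> S \<and> j \<in> S then Poly_Mapping.lookup v (i, j) else 0)"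
  using lookup_lact_reindex[OF assms, of id] lookup_ract_reindex[OF assms, of _ id] F_adj_diag[OF assms]
  by (simp add: F_diag_reindex lim.lact_ract)

lemma compress_diag_iff:
  assumes "finite S"
  shows "F_diag S \<triangleright> v \<triangleleft> F_diag S = v
    \<longleftrightarrow> (\<forall>i j. i \<notin> S \<or> j \<notin> S \<longrightarrow> Poly_Mapping.lookup v (i, j) = 0)"
proof
  assume "F_diag S \<triangleright> v \<triangleleft> F_diag S = v"
  then show "\<forall>i j. i \<notin> S \<or> j \<notin> S \<longrightarrow> Poly_Mapping.lookup v (i, j) = 0"
    using lookup_compress_diag[OF assms, of v] by metis
next
  assume "\<forall>i j. i \<notin> S \<or> j \<notin> S \<longrightarrow> Poly_Mapping.lookup v (i, j) = 0"
  then show "F_diag S \<triangleright> v \<triangleleft> F_diag S = v"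
    by (intro finmat_eqI) (auto simp: lookup_compress_diag[OF assms])
qed

lemma compress_I_iff: "F_I n \<triangleright> v \<triangleleft> F_I n = v \<longleftrightarrow> supported n v"
  unfolding F_I_def compress_diag_iff[OF finite_lessThan] supported_def by auto

lemma lookup_lact_I [simp]:
  "Poly_Mapping.lookup (F_I n \<triangleright> v) (i, j) = (if i < n then Poly_Mapping.lookup v (i, j) else 0)"
  using lookup_lact_reindex[of "{..<n}" id] F_adj_I by (simp add: F_I_reindex)

lemma lookup_ract_I [simp]:
  "Poly_Mapping.lookup (v \<triangleleft> F_I n) (i, j) = (if j < n then Poly_Mapping.lookup v (i, j) else 0)"
  by (simp add: F_I_reindex lookup_ract_reindex)

lemma lookup_ract_J [simp]:
  "Poly_Mapping.lookup (v \<triangleleft> F_J n) (i, j)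
    = (if n \<le> j \<and> j < 2 * n then Poly_Mapping.lookup v (i, j - n) else 0)"
  by (simp add: F_J_reindex lookup_ract_reindex)

lemma lookup_lact_J [simp]:
  "Poly_Mapping.lookup (F_adj (F_J n) \<triangleright> v) (i, j)
    = (if n \<le> i \<and> i < 2 * n then Poly_Mapping.lookup v (i - n, j) else 0)"
  by (simp add: F_J_reindex lookup_lact_reindex)

lemma lact_I: "supported n v \<Longrightarrow> F_I n \<triangleright> v = v"
  by (rule finmat_eqI) (auto simp: supportedD)

lemma ract_I: "supported n v \<Longrightarrow> v \<triangleleft> F_I n = v"
  by (rule finmat_eqI) (auto simp: supportedD)

sublocale lim: nondegenerate_F_bimodule lact ract
  by unfold_locales (use ex_supported in \<open>auto simp: compress_I_iff\<close>)

lemma elt_order: "0 < lim.elt_order v \<and> supported (lim.elt_order v) v"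
  unfolding lim.elt_order_def compress_I_iff by (rule LeastI_ex[OF ex_supported])

lemma elt_order_le: "0 < n \<Longrightarrow> supported n v \<Longrightarrow> lim.elt_order v \<le> n"
  unfolding lim.elt_order_def compress_I_iff by (rule Least_le) simp

text \<open>The order of v in the definition of \<open>scl\<close> disappears here, because
  \<open>F_I n\<close> acts as the identity on v for n equal to that order.\<close>

lemma lookup_rscl [simp]:
  "Poly_Mapping.lookup (lim.rscl k v) (i, j) = scale (of_real k) (Poly_Mapping.lookup v (i, j))"
proof -
  define n where "n = lim.elt_order v"
  have v: "supported n v" by (simp add: n_def elt_order)
  have "Poly_Mapping.lookup (lim.rscl k v) (i, j)
      = (\<Sum>l<n. if i = l then scale (of_real k) (Poly_Mapping.lookup v (l, j)) else 0)"
    unfolding lim.rscl_def lim.scl_def n_def[symmetric] lookup_lact[OF disjI2[OF v]]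
    by (intro sum.cong refl) (auto simp: F_I_reindex lookup_reindex_mat)
  also have "\<dots> = scale (of_real k) (Poly_Mapping.lookup v (i, j))"
    by (simp add: supportedD[OF v])
  finally show ?thesis .
qed

lemma supported_rscl: "supported n v \<Longrightarrow> supported n (lim.rscl k v)"
  by (rule supportedI) (auto simp: supportedD)

lemma corner_rscl [simp]: "corner n (lim.rscl k v) = mat_scale scale k (corner n v)"
  by (rule eq_matI) (auto simp: mat_scale_def)

lemma lookup_pair_pos [simp]:
  "Poly_Mapping.lookup (lim.pair_pos n u v) (i, j) = Poly_Mapping.lookup u (i, j)
    + (if n \<le> i \<and> i < 2 * n \<and> n \<le> j \<and> j < 2 * n then Poly_Mapping.lookup v (i - n, j - n) else 0)"
  by (simp add: lim.pair_pos_def lookup_add lim.lact_ract)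

lemma lookup_sa_part [simp]:
  "Poly_Mapping.lookup (lim.sa_part n v) (i, j)
    = (if i < n \<and> n \<le> j \<and> j < 2 * n then Poly_Mapping.lookup v (i, j - n) else 0)
    + (if j < n \<and> n \<le> i \<and> i < 2 * n then star (Poly_Mapping.lookup v (j, i - n)) else 0)"
  by (simp add: lim.sa_part_def lookup_add lim.lact_ract)

lemma supported_pair_pos:
  "supported n u \<Longrightarrow> supported n v \<Longrightarrow> supported (2 * n) (lim.pair_pos n u v)"
  by (rule supportedI) (auto simp: supportedD)

lemma supported_sa_part: "supported (2 * n) (lim.sa_part n v)"
  by (rule supportedI) auto

lemma corner_pair_pos:
  "supported n u \<Longrightarrow> corner (2 * n) (lim.pair_pos n u v) = corner n u \<oplus>\<^sub>d corner n v"
  by (rule eq_matI) (auto simp: mat_sum_def supportedD)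

lemma corner_pair_sa:
  assumes "supported n u" "supported n v"
  shows "corner (2 * n) (lim.pair_pos n u w + lim.sa_part n v)
    = four_block_mat (corner n u) (corner n v) (mat_adj star (corner n v)) (corner n w)"
  by (rule eq_matI) (use assms in \<open>auto simp: supportedD mat_adj_def lookup_add\<close>)

lemma pair_pos_minus:
  "lim.pair_pos n (u - u') (v - v') = lim.pair_pos n u v - lim.pair_pos n u' v'"
  by (rule finmat_eqI) (auto simp: lookup_minus)

text \<open>The index set is arbitrary because besides the order unit of a corner, where it is an
  initial segment, the diagonal summand gained on enlarging a corner is also of this form.\<close>

lemma lookup_diag_sum:
  assumes "finite C"
  shows "Poly_Mapping.lookup (\<Sum>k\<in>C. F_unit k 0 \<triangleright> x \<triangleleft> F_unit 0 k) (i, j)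
    = (if i = j \<and> i \<in> C then Poly_Mapping.lookup x (0, 0) else 0)"
proof -
  have "Poly_Mapping.lookup (\<Sum>k\<in>C. F_unit k 0 \<triangleright> x \<triangleleft> F_unit 0 k) (i, j)
      = (\<Sum>k\<in>C. if i = k then (if i = j then Poly_Mapping.lookup x (0, 0) else 0) else 0)"
    unfolding lookup_sum
  proof (intro sum.cong refl)
    fix k
    show "Poly_Mapping.lookup (F_unit k 0 \<triangleright> x \<triangleleft> F_unit 0 k) (i, j)
        = (if i = k then (if i = j then Poly_Mapping.lookup x (0, 0) else 0) else 0)"
      by (simp add: F_unit_adj[of k 0] F_unit_reindex[of 0 k] lookup_ract_reindex lookup_lact_reindex)
  qed
  then show ?thesis by (simp add: sum.delta'[OF assms])
qed

lemma lookup_corner_unit [simp]: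
  "Poly_Mapping.lookup (lim.corner_unit x n) (i, j)
    = (if i = j \<and> i < n then Poly_Mapping.lookup x (0, 0) else 0)"
  by (simp add: lim.corner_unit_def lookup_diag_sum)

lemma supported_corner_unit [simp]: "supported n (lim.corner_unit x n)"
  by (rule supportedI) auto

lemma corner_corner_unit:
  "corner n (lim.corner_unit (lim_map 1 (unit_mat x 1)) n) = unit_mat x n"
  by (rule eq_matI) (auto simp: unit_mat_def)

end

section \<open>The order of the limit\<close>

context involutive_space
begin

lemma lookup_lact_scale: "Poly_Mapping.lookup (F_scale c a \<triangleright> v) (i, j)
    = scale c (Poly_Mapping.lookup (a \<triangleright> v) (i, j))"
proof -
  obtain n where "supported n v" using ex_supported by blast
  then show ?thesis by (simp add: lookup_lact[of n] scale_sum_right)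
qed

lemma lookup_ract_scale: "Poly_Mapping.lookup (v \<triangleleft> F_scale c a) (i, j)
    = scale c (Poly_Mapping.lookup (v \<triangleleft> a) (i, j))"
proof -
  obtain n where "supported n v" using ex_supported by blast
  then show ?thesis by (simp add: lookup_ract[of n] scale_sum_right)
qed

text \<open>This is the value of the sesquilinear form with matrix v at the vector having 1 in place
  i and c in place j (both in place i if j = i): the compressing matrix carries this vector in
  column 0 and vanishes elsewhere. Polarization recovers the entries of v from such values.\<close>

lemma lookup_compress_unit_pair:
  "Poly_Mapping.lookup (F_adj (F_unit i 0 + F_scale c (F_unit j 0)) \<triangleright> v
      \<triangleleft> (F_unit i 0 + F_scale c (F_unit j 0))) (0, 0)
    = Poly_Mapping.lookup v (i, i) + scale c (Poly_Mapping.lookup v (i, j))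
      + scale (cnj c) (Poly_Mapping.lookup v (j, i)) + scale (cnj c * c) (Poly_Mapping.lookup v (j, j))"
proof -
  have adj: "F_adj (F_unit i 0 + F_scale c (F_unit j 0))
      = F_adj (F_unit i 0) + F_scale (cnj c) (F_adj (F_unit j 0))"
    by (rule finmat_eqI) (simp add: lookup_add)
  show ?thesis
    unfolding adj
    by (simp add: lookup_add lim.lact_add_left lim.ract_add_right lim.ract_add_left
        lookup_ract_scale lim.lact_ract lookup_lact_scale F_unit_reindex
        lookup_ract_reindex lookup_lact_reindex scale_right_distrib)
qed

end

context matrix_ordered_space
begin

abbreviation P :: "'v finmat set" where
  "P \<equiv> lim_cone cone"

lemma cone_msa: "0 < n \<Longrightarrow> cone n \<subseteq> msa n"
  by (rule real_ordered_vector_space.cone_sub[OF matrix_ordered])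

lemma cone_carrier: "0 < n \<Longrightarrow> v \<in> cone n \<Longrightarrow> v \<in> carrier_mat n n"
  using cone_msa by (auto simp: msa_def)

text \<open>The union defining \<open>P\<close> offers a positive matrix u of some other size m.
  Compression by the truncated m x n identity cuts u down or pads it with zeros; in either case the
  result is the corner of x, so positivity can be tested in any size that holds x.\<close>

lemma mem_lim_cone_iff:
  assumes n: "0 < n" and x: "supported n x"
  shows "x \<in> P \<longleftrightarrow> corner n x \<in> cone n"
proof
  assume "x \<in> P"
  then obtain m u where m: "0 < m" and u: "u \<in> cone m" and xu: "x = lim_map m u"
    unfolding lim_cone_def by auto
  have uc: "dim_row u = m" "dim_col u = m" using cone_carrier[OF m u] by auto
  define \<alpha> :: "complex mat" where "\<alpha> = mat m n (\<lambda>(i, j). if i = j then 1 else 0)"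
  have right: "mat_right scale u \<alpha> $$ (k, j) = (if j < m then u $$ (k, j) else 0)"
    if "k < m" "j < n" for k j
  proof -
    have "mat_right scale u \<alpha> $$ (k, j) = (\<Sum>l<m. if j = l then u $$ (k, l) else 0)"
    proof -
      have "mat_right scale u \<alpha> $$ (k, j) = (\<Sum>l<m. scale (\<alpha> $$ (l, j)) (u $$ (k, l)))"
        using that uc by (simp add: mat_right_def \<alpha>_def)
      also have "\<dots> = (\<Sum>l<m. if j = l then u $$ (k, l) else 0)"
        using that by (intro sum.cong refl) (auto simp: \<alpha>_def)
      finally show ?thesis .
    qed
    then show ?thesis by simp
  qed
  have "mat_left scale (mat_adj cnj \<alpha>) (mat_right scale u \<alpha>) = corner n x"
  proof (rule eq_matI)
    fix i j assume ij: "i < dim_row (corner n x)" "j < dim_col (corner n x)"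
    have "mat_left scale (mat_adj cnj \<alpha>) (mat_right scale u \<alpha>) $$ (i, j)
        = (\<Sum>k<m. scale (mat_adj cnj \<alpha> $$ (i, k)) (mat_right scale u \<alpha> $$ (k, j)))"
      using ij uc by (simp add: mat_left_def mat_right_def mat_adj_def \<alpha>_def)
    also have "\<dots> = (\<Sum>k<m. if i = k then (if j < m then u $$ (k, j) else 0) else 0)"
    proof (intro sum.cong refl)
      fix k assume "k \<in> {..<m}"
      then have "mat_adj cnj \<alpha> $$ (i, k) = (if i = k then 1 else 0)" and "k < m"
        using ij by (simp_all add: mat_adj_def \<alpha>_def)
      then show "scale (mat_adj cnj \<alpha> $$ (i, k)) (mat_right scale u \<alpha> $$ (k, j))
          = (if i = k then (if j < m then u $$ (k, j) else 0) else 0)"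
        using ij right[of k j] by auto
    qed
    also have "\<dots> = corner n x $$ (i, j)"
      using ij by (simp add: xu)
    finally show "mat_left scale (mat_adj cnj \<alpha>) (mat_right scale u \<alpha>) $$ (i, j) = corner n x $$ (i, j)" .
  qed (simp_all add: mat_left_def mat_right_def mat_adj_def \<alpha>_def)
  moreover have "mat_left scale (mat_adj cnj \<alpha>) (mat_right scale u \<alpha>) \<in> cone n"
    by (rule compress[OF n m u]) (simp add: \<alpha>_def)
  ultimately show "corner n x \<in> cone n" by simp
next
  assume "corner n x \<in> cone n"
  then show "x \<in> P"
    unfolding lim_cone_def using n lim_map_corner[OF x] by force
qed

lemma lim_map_in_cone: "0 < n \<Longrightarrow> v \<in> cone n \<Longrightarrow> lim_map n v \<in> P"
  unfolding lim_cone_def by auto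

lemma mem_msa_corner:
  assumes "supported n x"
  shows "corner n x \<in> msa n \<longleftrightarrow> lim_star star x = x"
proof -
  have "mat_adj star (corner n x) = corner n x \<longleftrightarrow> lim_star star x = x"
    unfolding corner_star[symmetric] using assms corner_inj supported_star by metis
  then show ?thesis by (simp add: msa_def)
qed

lemma lim_ordered_bimodule: "nondegenerate_ordered_F_bimodule lact ract (lim_star star) P"
proof unfold_locales
  fix v w :: "'v finmat" and a :: F
  obtain n where n: "0 < n" and v: "supported n v" and w: "supported n w"
    using ex_supported2 by blast
  show "lim_star star v = v" if "v \<in> P"
    using that mem_lim_cone_iff[OF n v] mem_msa_corner[OF v] cone_msa[OF n] by auto
  show "v + w \<in> P" if "v \<in> P" "w \<in> P"
    using that mem_lim_cone_iff[OF n v] mem_lim_cone_iff[OF n w]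
      mem_lim_cone_iff[OF n supported_add[OF v w]]
      real_ordered_vector_space.cone_add[OF matrix_ordered[OF n]] by simp
  obtain m where m: "0 < m" and v: "supported m v" and a: "supported m a"
    using ex_supported_ge[of n a] v n by (metis supported_mono)
  show "F_adj a \<triangleright> v \<triangleleft> a \<in> P" if "v \<in> P"
  proof -
    have va: "supported m (v \<triangleleft> a)" using a v by (rule supported_ract)
    have "corner m (F_adj a \<triangleright> (v \<triangleleft> a)) \<in> cone m"
      unfolding corner_lact[OF va] corner_ract[OF v] corner_F_adj
      using that mem_lim_cone_iff[OF m v] compress[OF m m] by simp
    then show ?thesis
      using mem_lim_cone_iff[OF m supported_lact[OF supported_F_adj[OF a] va]]
      by (simp add: lim.lact_ract)
  qed
qed

sublocale lim: nondegenerate_ordered_F_bimodule lact ract "lim_star star" P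
  by (rule lim_ordered_bimodule)

lemma P_zero: "0 \<in> P"
  using mem_lim_cone_iff[of 1 0] real_ordered_vector_space.cone_zero[OF matrix_ordered, of 1] by simp

lemma P_sum: "(\<And>i. i \<in> A \<Longrightarrow> f i \<in> P) \<Longrightarrow> sum f A \<in> P"
  by (induction A rule: infinite_finite_induct) (auto simp: P_zero lim.P_add)

lemma P_rscl:
  assumes "v \<in> P" "0 \<le> k"
  shows "lim.rscl k v \<in> P"
proof -
  obtain n where n: "0 < n" and v: "supported n v" using ex_supported by blast
  then show ?thesis
    using assms mem_lim_cone_iff[OF n v] mem_lim_cone_iff[OF n supported_rscl[OF v]]
      real_ordered_vector_space.cone_smul[OF matrix_ordered[OF n]] by simp
qed

lemma P_pair_pos: "u \<in> P \<Longrightarrow> v \<in> P \<Longrightarrow> lim.pair_pos n u v \<in> P"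
  unfolding lim.pair_pos_def by (intro lim.P_add lim.P_compress)

lemma le_rscl:
  assumes "v \<in> P" "k \<le> 1"
  shows "lim.le (lim.rscl k v) v"
proof -
  have "v - lim.rscl k v = lim.rscl (1 - k) v"
    by (rule finmat_eqI) (simp add: lookup_minus scale_left_diff_distrib)
  then show ?thesis using P_rscl[of v "1 - k"] assms by (simp add: lim.le_def)
qed

lemma le_trans: "lim.le u v \<Longrightarrow> lim.le v w \<Longrightarrow> lim.le u w"
  unfolding lim.le_def using lim.P_add[of "w - v" "v - u"] by simp

end

section \<open>Properness and the Archimedean property\<close>

context matrix_order_unit_space
begin

text \<open>Compressing x and -x by the same matrix and passing to the entry (0, 0) leads into the 1
  x 1 cone, whose properness forces that entry to vanish. Hence the quadratic form of x vanishes on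
  combinations of two basis vectors, and x = 0 by polarization.\<close>

lemma P_proper:
  assumes x: "x \<in> P" and mx: "- x \<in> P"
  shows "x = 0"
proof -
  have zero: "Poly_Mapping.lookup y (0, 0) = 0" if "y \<in> P" "- y \<in> P" for y
  proof -
    define z where "z = F_I 1 \<triangleright> y \<triangleleft> F_I 1"
    have sup: "supported 1 z" "supported 1 (- z)"
      unfolding z_def by (auto intro!: supportedI simp: lim.lact_ract)
    have "- z = F_adj (F_I 1) \<triangleright> (- y) \<triangleleft> F_I 1"
      by (rule finmat_eqI) (simp add: z_def F_adj_I lim.lact_ract)
    then have "z \<in> P" "- z \<in> P"
      using lim.P_compress[OF that(1), of "F_I 1"] lim.P_compress[OF that(2), of "F_I 1"]
      by (simp_all add: z_def F_adj_I)
    then have "corner 1 z \<in> cone 1" "- corner 1 z \<in> cone 1"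
      using mem_lim_cone_iff[OF _ sup(1)] mem_lim_cone_iff[OF _ sup(2)] by simp_all
    moreover have "corner 1 z = - (- corner 1 z)" by (rule eq_matI) auto
    ultimately have "corner 1 z \<in> cone 1 \<inter> uminus ` cone 1" by blast
    then have "corner 1 z = 0\<^sub>m 1 1" unfolding proper by simp
    then have "corner 1 z $$ (0, 0) = 0" by simp
    then show ?thesis by (simp add: z_def lim.lact_ract)
  qed
  let ?l = "Poly_Mapping.lookup x"
  have q: "?l (i, i) + scale c (?l (i, j)) + scale (cnj c) (?l (j, i)) + scale (cnj c * c) (?l (j, j)) = 0"
    for i j c
  proof -
    define a where "a = F_unit i 0 + F_scale c (F_unit j 0)"
    have "- (F_adj a \<triangleright> x \<triangleleft> a) = F_adj a \<triangleright> (- x) \<triangleleft> a"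
      using lim.lact_add_right[of "F_adj a" x "- x"] lim.lact_add_right[of "F_adj a" 0 0]
        lim.ract_add_left[of "F_adj a \<triangleright> x" "F_adj a \<triangleright> (- x)" a] lim.ract_add_left[of 0 0 a]
      by (simp add: eq_neg_iff_add_eq_0 minus_unique)
    then have "Poly_Mapping.lookup (F_adj a \<triangleright> x \<triangleleft> a) (0, 0) = 0"
      using zero lim.P_compress[OF x, of a] lim.P_compress[OF mx, of a] by simp
    then show ?thesis unfolding a_def lookup_compress_unit_pair .
  qed
  \<comment> \<open>The choices c = 0, c = 1 and c the imaginary unit give in turn the diagonal
    entry, the sum, and a multiple of the difference, of the entries at (i, j) and (j, i).\<close>
  have diag: "?l (i, i) = 0" for i using q[of i 0 i] by simp
  show ?thesis
  proof (rule finmat_eqI)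
    fix i j
    have "?l (i, j) + ?l (j, i) = 0" using q[of i 1 j] by (simp add: diag)
    moreover have "scale \<i> (?l (i, j) - ?l (j, i)) = 0"
      using q[of i \<i> j] by (simp add: diag scale_right_diff_distrib scale_minus_left)
    ultimately have "?l (i, j) + ?l (i, j) = 0" by simp
    then have "scale 2 (?l (i, j)) = 0"
      using scale_left_distrib[of 1 1 "?l (i, j)"] by simp
    then show "?l (i, j) = Poly_Mapping.lookup 0 (i, j)" by simp
  qed
qed

lemma le_antisym: "lim.le u v \<Longrightarrow> lim.le v u \<Longrightarrow> u = v"
  using P_proper[of "v - u"] by (simp add: lim.le_def)

lemma lim_archimedean:
  assumes v: "lim_star star v = v" and u: "u \<in> P" and k: "\<And>k. 0 < k \<Longrightarrow> lim.rscl k u + v \<in> P"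
  shows "v \<in> P"
proof -
  obtain n where n: "0 < n" and su: "supported n u" and sv: "supported n v"
    using ex_supported2 by blast
  have "corner n v \<in> cone n"
  proof (rule archimedean[OF n])
    show "corner n v \<in> msa n" using mem_msa_corner[OF sv] v by simp
    show "corner n u \<in> cone n" using mem_lim_cone_iff[OF n su] u by simp
    show "mat_scale scale k (corner n u) + corner n v \<in> cone n" if "0 < k" for k
      using k[OF that] mem_lim_cone_iff[OF n supported_add[OF supported_rscl[OF su] sv]] by simp
  qed
  then show ?thesis using mem_lim_cone_iff[OF n sv] by simp
qed

end

section \<open>The absolute value of the limit\<close>

context absolute_matrix_order_unit_space
begin

abbreviation labs :: "'a finmat \<Rightarrow> 'a finmat" where
  "labs \<equiv> lim_abs scale mav"

lemma mav_carrier: "0 < n \<Longrightarrow> v \<in> carrier_mat n n \<Longrightarrow> mav n n v \<in> carrier_mat n n"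
  using mav_pos[of n n v] cone_carrier[of n] by simp

lemma mav_of_cone: "0 < n \<Longrightarrow> v \<in> cone n \<Longrightarrow> mav n n v = v"
  by (rule absolutely_ordered_space.av_fix[OF mav_square])

lemma labs_eq:
  assumes n: "0 < n" and v: "supported n v"
  shows "labs v = lim_map n (mav n n (corner n v))"
proof -
  define m where "m = lim.elt_order v"
  have m: "0 < m" "supported m v" "m \<le> n"
    using elt_order elt_order_le[OF n v] by (auto simp: m_def)
  have labs: "labs v = lim_map m (mav m m (corner m v))"
    by (simp add: lim_abs_def m_def Let_def inv_lim_map elt_order)
  show ?thesis
  proof (cases "m = n")
    \<comment> \<open>Equality of sizes is split off because the axiom on block sums speaks only of
      blocks of positive size.\<close>
    case False
    then have k: "0 < n - m" "m + (n - m) = n" using m by auto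
    let ?z = "0\<^sub>m (n - m) (n - m)"
    have z: "?z \<in> cone (n - m)"
      by (rule real_ordered_vector_space.cone_zero[OF matrix_ordered[OF k(1)]])
    have "corner n v = corner m v \<oplus>\<^sub>d ?z"
      by (rule eq_matI) (use m k in \<open>auto simp: mat_sum_def supportedD\<close>)
    then have "mav n n (corner n v) = mav m m (corner m v) \<oplus>\<^sub>d ?z"
      using mav_sum[of m m "n - m" "n - m" "corner m v" ?z] m k mav_of_cone[OF k(1) z] by simp
    then show ?thesis
      unfolding labs
      by (intro finmat_eqI) (use m mav_carrier[OF m(1), of "corner m v"] in \<open>auto simp: mat_sum_def\<close>)
  qed (use labs in simp)
qed

lemma supported_labs: "0 < n \<Longrightarrow> supported n v \<Longrightarrow> supported n (labs v)"
  by (simp add: labs_eq)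

lemma corner_labs: "0 < n \<Longrightarrow> supported n v \<Longrightarrow> corner n (labs v) = mav n n (corner n v)"
  by (simp add: labs_eq corner_lim_map mav_carrier)

lemma labs_pos: "labs v \<in> P"
proof -
  obtain n where n: "0 < n" "supported n v" using ex_supported by blast
  then show ?thesis by (simp add: labs_eq lim_map_in_cone mav_pos)
qed

lemma labs_of_pos:
  assumes "v \<in> P"
  shows "labs v = v"
proof -
  obtain n where n: "0 < n" "supported n v" using ex_supported by blast
  then show ?thesis
    using assms by (simp add: labs_eq mem_lim_cone_iff mav_of_cone lim_map_corner)
qed

lemma labs_mult: "lim.le (labs (a \<triangleright> v \<triangleleft> b)) (lim.rscl (F_norm a) (labs (labs v \<triangleleft> b)))"
proof -
  obtain m where ab: "supported m a" "supported m b" using ex_supported2[of 0 a b] by blast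
  obtain n where "m \<le> n" and n: "0 < n" and v: "supported n v" using ex_supported_ge by blast
  with ab have a: "supported n a" and b: "supported n b" by (auto intro: supported_mono)
  note s = supported_labs[OF n v]
  have sl: "supported n (labs (a \<triangleright> v \<triangleleft> b))"
    and sr: "supported n (lim.rscl (F_norm a) (labs (labs v \<triangleleft> b)))"
    using n v a b by (simp_all add: supported_labs supported_ract supported_lact supported_rscl)
  have "corner n (lim.rscl (F_norm a) (labs (labs v \<triangleleft> b)) - labs (a \<triangleright> v \<triangleleft> b)) \<in> cone n"
    using mav_mult[OF n n n n, of "corner n v" "corner n a" "corner n b"] n v a b s
    by (simp add: corner_labs corner_ract corner_lact supported_ract supported_lact F_norm_corner)
  then show ?thesis
    unfolding lim.le_def using mem_lim_cone_iff[OF n supported_minus[OF sr sl]] by simp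
qed

lemma labs_contraction:
  assumes "F_norm a \<le> 1"
  shows "lim.le (labs (a \<triangleright> v \<triangleleft> b)) (labs (labs v \<triangleleft> b))"
  using labs_mult le_rscl[OF labs_pos assms] by (rule le_trans)

text \<open>Here \<open>pair_pos\<close> serves as the block sum of arbitrary elements, positive or
  not, so this is the direct sum axiom read in the limit.\<close>

lemma labs_pair_pos:
  assumes n: "0 < n" and u: "supported n u" and v: "supported n v"
  shows "labs (lim.pair_pos n u v) = lim.pair_pos n (labs u) (labs v)"
proof (rule corner_inj)
  have N: "0 < 2 * n" using n by simp
  show "supported (2 * n) (labs (lim.pair_pos n u v))"
    and "supported (2 * n) (lim.pair_pos n (labs u) (labs v))"
    using N n u v by (simp_all add: supported_labs supported_pair_pos)
  show "corner (2 * n) (labs (lim.pair_pos n u v)) = corner (2 * n) (lim.pair_pos n (labs u) (labs v))"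
    using mav_sum[OF n n n n, of "corner n u" "corner n v"] N n u v
    by (simp add: corner_labs supported_pair_pos corner_pair_pos supported_labs mult_2[symmetric])
qed

section \<open>Invariance of the absolute value under involutive permutations\<close>

context
  fixes n :: nat and p :: "nat \<Rightarrow> nat" and W :: F
  assumes pp: "\<And>i. p (p i) = i" and pn: "\<And>i. i < n \<Longrightarrow> p i < n" and n: "0 < n"
  defines "W \<equiv> reindex_mat {..<n} p"
begin

lemma lookup_lact_involution:
  "Poly_Mapping.lookup (W \<triangleright> v) (i, j) = (if i < n then Poly_Mapping.lookup v (p i, j) else 0)"
  using lookup_lact_reindex[of "{..<n}" p v] F_adj_involution[OF pp pn]
  by (simp add: W_def)

lemma lookup_ract_involution:
  "Poly_Mapping.lookup (v \<triangleleft> W) (i, j) = (if j < n then Poly_Mapping.lookup v (i, p j) else 0)"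
  by (simp add: W_def lookup_ract_reindex)

lemma F_adj_W: "F_adj W = W"
  unfolding W_def by (rule F_adj_involution[OF pp pn])

lemma supported_lact_involution:
  "supported n v \<Longrightarrow> supported n (W \<triangleright> v)" "supported n v \<Longrightarrow> supported n (v \<triangleleft> W)"
  by (rule supportedI; auto simp: lookup_lact_involution lookup_ract_involution supportedD)+

lemma lact_W_W: "supported n v \<Longrightarrow> W \<triangleright> W \<triangleright> v = v"
  by (rule finmat_eqI) (auto simp: lookup_lact_involution supportedD pp pn)

lemma ract_W_W: "supported n v \<Longrightarrow> v \<triangleleft> W \<triangleleft> W = v"
  by (rule finmat_eqI) (auto simp: lookup_ract_involution supportedD pp pn)

text \<open>Taking \<open>F_I n\<close> as the right factor leaves |x| alone, and | |x| | = |x|, so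
  the contraction bound reads |W x| \<le> |x|. For x = W v it gives the reverse inequality, because
  W W v = v.\<close>

lemma labs_lact_involution:
  assumes v: "supported n v"
  shows "labs (W \<triangleright> v) = labs v"
proof -
  have le: "lim.le (labs (W \<triangleright> x)) (labs x)" if x: "supported n x" for x
  proof -
    have "F_norm W \<le> 1" unfolding W_def by (rule F_norm_involution[OF pp pn])
    from labs_contraction[OF this, of x "F_I n"]
    show ?thesis
      using x n by (simp add: ract_I supported_lact_involution supported_labs labs_of_pos labs_pos)
  qed
  show ?thesis
    using le[OF v] le[OF supported_lact_involution(1)[OF v]]
    by (auto simp: lact_W_W[OF v] intro: le_antisym)
qed

text \<open>The bound | |x| W | equals W |x| W: left invariance inserts W on the left without
  changing the absolute value, and W |x| W is positive, hence its own absolute value.\<close>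

lemma labs_ract_involution:
  assumes v: "supported n v"
  shows "labs (v \<triangleleft> W) = W \<triangleright> labs v \<triangleleft> W"
proof -
  have le: "lim.le (labs (x \<triangleleft> W)) (W \<triangleright> labs x \<triangleleft> W)" if x: "supported n x" for x
  proof -
    have pos: "W \<triangleright> labs x \<triangleleft> W \<in> P" using lim.P_compress[OF labs_pos, of W x] by (simp add: F_adj_W)
    have "labs (labs x \<triangleleft> W) = labs (W \<triangleright> labs x \<triangleleft> W)"
      using x n by (simp add: lim.lact_ract labs_lact_involution supported_lact_involution supported_labs)
    also have "\<dots> = W \<triangleright> labs x \<triangleleft> W" by (rule labs_of_pos[OF pos])
    finally show ?thesis
      using labs_contraction[OF F_norm_I, of n x W] x by (simp add: lact_I)
  qed
  \<comment> \<open>The reverse inequality comes from the element v W, whose product with W is v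
    again; conjugating by W then isolates |v W|.\<close>
  have "lim.le (labs v) (W \<triangleright> labs (v \<triangleleft> W) \<triangleleft> W)"
    using le[OF supported_lact_involution(2)[OF v]] by (simp add: ract_W_W[OF v])
  then have "W \<triangleright> (W \<triangleright> labs (v \<triangleleft> W) \<triangleleft> W - labs v) \<triangleleft> W \<in> P"
    unfolding lim.le_def using lim.P_compress[of _ W] by (simp add: F_adj_W)
  moreover have "W \<triangleright> (W \<triangleright> labs (v \<triangleleft> W) \<triangleleft> W - labs v) \<triangleleft> W = labs (v \<triangleleft> W) - (W \<triangleright> labs v \<triangleleft> W)"
  proof (rule finmat_eqI)
    fix i j
    have "supported n (labs (v \<triangleleft> W))"
      using n v by (simp add: supported_labs supported_lact_involution)
    then show "Poly_Mapping.lookup (W \<triangleright> (W \<triangleright> labs (v \<triangleleft> W) \<triangleleft> W - labs v) \<triangleleft> W) (i, j)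
        = Poly_Mapping.lookup (labs (v \<triangleleft> W) - (W \<triangleright> labs v \<triangleleft> W)) (i, j)"
      by (auto simp: lookup_ract_involution lookup_lact_involution lookup_minus supportedD pp pn)
  qed
  ultimately have "lim.le (W \<triangleright> labs v \<triangleleft> W) (labs (v \<triangleleft> W))" by (simp add: lim.le_def)
  then show ?thesis using le[OF v] by (auto intro: le_antisym)
qed

lemma labs_conj_involution:
  assumes v: "supported n v"
  shows "labs (W \<triangleright> v \<triangleleft> W) = W \<triangleright> labs v \<triangleleft> W"
  using v by (simp add: lim.lact_ract labs_lact_involution supported_lact_involution labs_ract_involution)

lemma lookup_conj_involution:
  "Poly_Mapping.lookup (W \<triangleright> v \<triangleleft> W) (i, j)
    = (if i < n \<and> j < n then Poly_Mapping.lookup v (p i, p j) else 0)"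
  by (simp add: lookup_ract_involution lookup_lact_involution)

end

section \<open>Block positivity, supports and independence\<close>

text \<open>Exchanging the two halves of the rows turns the block sum of \<open>star v\<close> and v
  into the off-diagonal element w = \<open>sa_part n v\<close>. So |w| is the block sum of the two
  absolute values, and |w| + w is positive because w is self-adjoint. The size is left free since
  the order unit property needs the case n = 1.\<close>

lemma labs_block:
  assumes n: "0 < n" and v: "supported n v"
  shows "lim.pair_pos n (labs (lim_star star v)) (labs v) + lim.sa_part n v \<in> P"
proof -
  define p where "p i = (if i < n then n + i else if i < 2 * n then i - n else i)" for i
  have p: "p (p i) = i" "i < 2 * n \<Longrightarrow> p i < 2 * n" for i by (auto simp: p_def)
  have N: "0 < 2 * n" using n by simp
  define w where "w = lim.sa_part n v"
  have w: "supported (2 * n) w" by (simp add: w_def supported_sa_part)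
  let ?d = "lim.pair_pos n (lim_star star v) v"
  note s = supported_star[OF v]
  have wd: "w = reindex_mat {..<2 * n} p \<triangleright> ?d"
    by (rule finmat_eqI)
      (use v s in \<open>auto simp: w_def lookup_lact_involution[OF p N] p_def supportedD\<close>)
  have "labs w = lim.pair_pos n (labs (lim_star star v)) (labs v)"
    unfolding wd using labs_lact_involution[OF p N supported_pair_pos[OF s v]] labs_pair_pos[OF n s v]
    by simp
  moreover have "labs w + w \<in> P"
  proof -
    have "lim_star star w = w"
      by (rule finmat_eqI) (auto simp: w_def star_add star_star)
    then have "corner (2 * n) w \<in> msa (2 * n)" using mem_msa_corner[OF w] by simp
    then have "mav (2 * n) (2 * n) (corner (2 * n) w) + corner (2 * n) w \<in> cone (2 * n)"
      by (rule absolutely_ordered_space.av_plus[OF mav_square[OF N]])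
    then show ?thesis
      using mem_lim_cone_iff[OF N supported_add[OF supported_labs[OF N w] w]] corner_labs[OF N w]
      by simp
  qed
  ultimately show ?thesis by (simp add: w_def)
qed

text \<open>
  For \<open>i \<notin> S\<close>, exchanging \<open>i\<close> with an index \<open>n\<close> outside the support of \<open>v\<close> and of \<open>|v|\<close> fixes \<open>v\<close>, hence
  fixes \<open>|v|\<close>; it moves row and column \<open>i\<close> of \<open>|v|\<close> to the vanishing row and column \<open>n\<close>.
\<close>

lemma labs_support:
  assumes "finite S" and v: "\<And>i j. i \<notin> S \<or> j \<notin> S \<Longrightarrow> Poly_Mapping.lookup v (i, j) = 0"
    and ij: "i \<notin> S \<or> j \<notin> S"
  shows "Poly_Mapping.lookup (labs v) (i, j) = 0"
proof -
  obtain m where m: "S \<subseteq> {..<m}" using finite_nat_bounded[OF assms(1)] by blast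
  obtain n where "m \<le> n" and n: "0 < n" and nv: "supported n v" using ex_supported_ge by blast
  with m have Sn: "S \<subseteq> {..<n}" by auto
  have nl: "supported n (labs v)" by (rule supported_labs[OF n nv])
  have zero: "Poly_Mapping.lookup (labs v) (i, j) = 0" if k: "k \<notin> S" and "i = k \<or> j = k" for i j k
  proof (cases "i < n \<and> j < n")
    case True
    define p where "p x = (if x = k then n else if x = n then k else x)" for x
    have "k < n" using True that by auto
    then have p: "p (p x) = x" "x < Suc n \<Longrightarrow> p x < Suc n" for x by (auto simp: p_def)
    let ?W = "reindex_mat {..<Suc n} p"
    have v': "supported (Suc n) v" by (rule supported_mono[OF nv]) simp
    have "?W \<triangleright> v \<triangleleft> ?W = v"
      by (rule finmat_eqI)
        (use k Sn in \<open>auto simp: lookup_conj_involution[OF p] p_def v supportedD[OF nv]\<close>)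
    then have "labs v = ?W \<triangleright> labs v \<triangleleft> ?W"
      using labs_conj_involution[OF p zero_less_Suc v'] by simp
    then have "Poly_Mapping.lookup (labs v) (i, j) = Poly_Mapping.lookup (labs v) (p i, p j)"
      using True lookup_conj_involution[OF p zero_less_Suc, of "labs v" i j] by simp
    also have "\<dots> = 0"
      using that(2) by (intro supportedD[OF nl]) (auto simp: p_def)
    finally show ?thesis .
  qed (use supportedD[OF nl] in auto)
  show ?thesis using ij zero by blast
qed

lemma labs_independent:
  assumes "lim.F_independent u v"
  shows "labs (u + v) = labs u + labs v"
proof -
  obtain S T where fin: "finite S" "finite T" and ST: "S \<inter> T = {}"
    and "F_diag S \<triangleright> u \<triangleleft> F_diag S = u" "F_diag T \<triangleright> v \<triangleleft> F_diag T = v"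
    using assms unfolding lim.F_independent_def by blast
  then have u: "\<And>i j. i \<notin> S \<or> j \<notin> S \<Longrightarrow> Poly_Mapping.lookup u (i, j) = 0"
    and v: "\<And>i j. i \<notin> T \<or> j \<notin> T \<Longrightarrow> Poly_Mapping.lookup v (i, j) = 0"
    by (simp_all add: compress_diag_iff)
  obtain m where m: "S \<union> T \<subseteq> {..<m}" using finite_nat_bounded[of "S \<union> T"] fin by auto
  define n where "n = Suc m"
  have n: "0 < n" and Sn: "S \<subseteq> {..<n}" and Tn: "T \<subseteq> {..<n}" using m by (auto simp: n_def)
  have N: "0 < 2 * n" using n by simp
  \<comment> \<open>Exchanges T with its translate n + T, which meets neither S nor T, and fixes
    everything else, in particular S.\<close>
  define p where "p x = (if x \<in> T then n + x else if n \<le> x \<and> x - n \<in> T then x - n else x)" for x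
  have p: "p (p x) = x" "x < 2 * n \<Longrightarrow> p x < 2 * n" for x using Tn by (auto simp: p_def)
  let ?W = "reindex_mat {..<2 * n} p"
  have pS: "p x = x" if "x \<in> S" for x
  proof -
    have "x \<notin> T" "\<not> n \<le> x" using that Sn ST by auto
    then show ?thesis by (simp add: p_def)
  qed
  have pS_iff: "p x \<in> S \<longleftrightarrow> x \<in> S" for x using pS[of x] pS[of "p x"] p(1)[of x] by auto
  have pT: "p x = x - n" if "n \<le> x" "x - n \<in> T" for x
  proof -
    have "x \<notin> T" using that(1) Tn by auto
    then show ?thesis using that by (simp add: p_def)
  qed
  have pT_iff: "p x \<in> T \<longleftrightarrow> n \<le> x \<and> x - n \<in> T" for x
  proof
    assume "p x \<in> T"
    then have "p (p x) = n + p x" by (simp add: p_def)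
    then have "x = n + p x" by (simp add: p)
    then show "n \<le> x \<and> x - n \<in> T" using \<open>p x \<in> T\<close> by (metis add_diff_cancel_left' le_add1)
  qed (simp add: pT)
  \<comment> \<open>Stated for general x and y because it is applied both to u, v and to |u|, |v|;
    for the latter the supports are provided by \<open>labs_support\<close>.\<close>
  have split: "?W \<triangleright> (x + y) \<triangleleft> ?W = lim.pair_pos n x y"
    if x: "\<And>i j. i \<notin> S \<or> j \<notin> S \<Longrightarrow> Poly_Mapping.lookup x (i, j) = 0"
      and y: "\<And>i j. i \<notin> T \<or> j \<notin> T \<Longrightarrow> Poly_Mapping.lookup y (i, j) = 0" for x y :: "'a finmat"
  proof (rule finmat_eqI)
    fix i j
    have "Poly_Mapping.lookup x (p i, p j) = Poly_Mapping.lookup x (i, j)"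
      using x pS pS_iff by (cases "i \<in> S \<and> j \<in> S") auto
    moreover have "Poly_Mapping.lookup y (p i, p j)
        = (if n \<le> i \<and> n \<le> j then Poly_Mapping.lookup y (i - n, j - n) else 0)"
      using pT[of i] pT[of j] pT_iff[of i] pT_iff[of j] y[of "i - n" "j - n"] y[of "p i" "p j"]
      by (cases "p i \<in> T \<and> p j \<in> T") auto
    moreover have "Poly_Mapping.lookup x (i, j) = 0" if "2 * n \<le> i \<or> 2 * n \<le> j"
      using that Sn by (intro x) auto
    ultimately show "Poly_Mapping.lookup (?W \<triangleright> (x + y) \<triangleleft> ?W) (i, j)
        = Poly_Mapping.lookup (lim.pair_pos n x y) (i, j)"
      by (auto simp: lookup_conj_involution[OF p N] lookup_add)
  qed
  have su: "supported n u" and sv: "supported n v"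
    using Sn Tn by (auto intro!: supportedI u v)
  have s1: "supported (2 * n) (labs (u + v))" and s2: "supported (2 * n) (labs u + labs v)"
    and s3: "supported (2 * n) (u + v)"
    by (rule supported_mono[of n], use n su sv in \<open>simp_all add: supported_labs supported_add\<close>)+
  have "?W \<triangleright> labs (u + v) \<triangleleft> ?W = labs (?W \<triangleright> (u + v) \<triangleleft> ?W)"
    using labs_conj_involution[OF p N s3] by simp
  also have "\<dots> = lim.pair_pos n (labs u) (labs v)"
    by (subst split) (simp_all add: u v labs_pair_pos[OF n su sv])
  also have "\<dots> = ?W \<triangleright> (labs u + labs v) \<triangleleft> ?W"
    by (subst split) (blast intro: labs_support[OF fin(1)] labs_support[OF fin(2)] u v)+
  finally have eq: "?W \<triangleright> labs (u + v) \<triangleleft> ?W = ?W \<triangleright> (labs u + labs v) \<triangleleft> ?W" .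
  \<comment> \<open>Conjugation by W is cancelled by reading the equation at (p i, p j), as p is its
    own inverse.\<close>
  have "Poly_Mapping.lookup (labs (u + v)) (i, j) = Poly_Mapping.lookup (labs u + labs v) (i, j)" for i j
  proof (cases "i < 2 * n \<and> j < 2 * n")
    case True
    then show ?thesis
      using arg_cong[OF eq, of "\<lambda>x. Poly_Mapping.lookup x (p i, p j)"]
      by (simp add: lookup_conj_involution[OF p N] p)
  qed (use supportedD[OF s1] supportedD[OF s2] in auto)
  then show ?thesis by (rule finmat_eqI)
qed

section \<open>The axioms of an absolutely ordered bimodule\<close>

lemma lim_absolutely_ordered:
  "nondegenerate_absolutely_ordered_F_bimodule lact ract (lim_star star) P labs"
proof unfold_locales
  fix u v w :: "'a finmat" and a b :: F
  show "labs v \<in> P" by (rule labs_pos)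
  show "lim.elt_order (labs v) \<le> lim.elt_order v"
    using elt_order by (intro elt_order_le supported_labs) auto
  show "labs v = v" if "v \<in> P" using that by (rule labs_of_pos)
  show "lim.pair_pos (lim.elt_order v) (labs (lim_star star v)) (labs v)
      + lim.sa_part (lim.elt_order v) v \<in> P"
    using elt_order by (intro labs_block) auto
  show "lim.le (labs (a \<triangleright> v \<triangleleft> b)) (lim.rscl (F_norm a) (labs (labs v \<triangleleft> b)))"
    by (rule labs_mult)
  show "labs (u + v) = labs u + labs v" if "lim.F_independent u v"
    using that by (rule labs_independent)
  obtain n where n: "0 < n" and s: "supported n u" "supported n v" "supported n w"
    using ex_supported3 by blast
  note A = mav_square[OF n]
  note sup = supported_labs[OF n] supported_add supported_minus s
  note mem = mem_lim_cone_iff[OF n]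
  \<comment> \<open>Orthogonality to u is read in the corner of size n for arbitrary x, since x also
    stands for |v + w| and |v - w|, which stay in that corner.\<close>
  have iff: "labs (u - x) = u + x \<longleftrightarrow>
      mav n n (corner n u - corner n x) = corner n u + corner n x" if "supported n x" for x
  proof -
    have "labs (u - x) = u + x \<longleftrightarrow> corner n (labs (u - x)) = corner n (u + x)"
      using corner_inj[OF supported_labs[OF n supported_minus[OF s(1) that]] supported_add[OF s(1) that]]
      by metis
    also have "corner n (labs (u - x)) = mav n n (corner n u - corner n x)"
      by (simp add: corner_labs[OF n supported_minus[OF s(1) that]])
    finally show ?thesis by simp
  qed
  have msa: "corner n x \<in> msa n" if "x \<in> P" "supported n x" for x
    using that mem cone_msa[OF n] by auto
  show "labs (u - w) = u + w"
    if "u \<in> P" "v \<in> P" "w \<in> P" "labs (u - v) = u + v" "lim.le w v"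
    using that sup absolutely_ordered_space.av_hereditary[OF A, of "corner n u" "corner n v" "corner n w"]
    by (simp add: iff msa mem lim.le_def mem[OF supported_minus[OF s(2) s(3)]])
  show "labs (u - labs (v + w)) = u + labs (v + w)"
    if "u \<in> P" "v \<in> P" "w \<in> P" "labs (u - v) = u + v" "labs (u - w) = u + w"
    using that absolutely_ordered_space.av_sum[OF A msa msa msa, of u v w] s
    unfolding iff[OF s(2)] iff[OF s(3)] iff[OF supported_labs[OF n supported_add[OF s(2,3)]]]
      corner_labs[OF n supported_add[OF s(2,3)]]
    by simp
  show "labs (u - labs (v - w)) = u + labs (v - w)"
    if "u \<in> P" "v \<in> P" "w \<in> P" "labs (u - v) = u + v" "labs (u - w) = u + w"
    using that absolutely_ordered_space.av_diff[OF A msa msa msa, of u v w] s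
    unfolding iff[OF s(2)] iff[OF s(3)] iff[OF supported_labs[OF n supported_minus[OF s(2,3)]]]
      corner_labs[OF n supported_minus[OF s(2,3)]]
    by simp
qed

sublocale lim: nondegenerate_absolutely_ordered_F_bimodule lact ract "lim_star star" P labs
  by (rule lim_absolutely_ordered)

end

section \<open>The order unit and its norm\<close>

context matrix_order_unit_space
begin

abbreviation lunit :: "'v finmat" where
  "lunit \<equiv> lim_map 1 (unit_mat e 1)"

lemma lunit_pos: "lunit \<in> P"
  using unit_pos by (intro lim_map_in_cone) auto

text \<open>The element whose positivity is tested in the infimum defining the norm of v, with the
  size n detached from the order of v.\<close>

definition unit_block :: "nat \<Rightarrow> real \<Rightarrow> 'v finmat \<Rightarrow> 'v finmat" where
  "unit_block n k v = lim.pair_pos n (lim.rscl k (lim.corner_unit lunit n))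
     (lim.rscl k (lim.corner_unit lunit n)) + lim.sa_part n v"

lemma lookup_unit_block:
  "Poly_Mapping.lookup (unit_block n k v) (i, j) = (if i = j \<and> i < 2 * n then scale (of_real k) e else 0)
    + (if i < n \<and> n \<le> j \<and> j < 2 * n then Poly_Mapping.lookup v (i, j - n) else 0)
    + (if j < n \<and> n \<le> i \<and> i < 2 * n then star (Poly_Mapping.lookup v (j, i - n)) else 0)"
  by (auto simp: unit_block_def lookup_add unit_mat_def)

text \<open>
  Enlarging the corner from \<open>m\<close> to \<open>n\<close> adds, up to a permutation, a diagonal summand with entries
  \<open>k e \<ge> 0\<close>.
\<close>

lemma unit_block_pos_mono:
  assumes mn: "m \<le> n" and v: "supported m v" and k: "0 \<le> k"
  shows "unit_block m k v \<in> P \<longleftrightarrow> unit_block n k v \<in> P"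
proof
  assume pos: "unit_block n k v \<in> P"
  \<comment> \<open>Each half of the smaller block goes to the beginning of the corresponding half
    of the larger one; the second halves begin at m and at n.\<close>
  define f where "f i = (if i < m then i else n + (i - m))" for i
  let ?a = "reindex_mat {..<2 * m} f"
  have f: "f i = f j \<longleftrightarrow> i = j" "f i < 2 * n" "f i < n \<longleftrightarrow> i < m" "n \<le> f i \<longleftrightarrow> m \<le> i"
    "i < m \<Longrightarrow> f i = i" "m \<le> i \<Longrightarrow> f i - n = i - m"
    if "i < 2 * m" "j < 2 * m" for i j
    using that mn by (auto simp: f_def)
  have "unit_block m k v = F_adj ?a \<triangleright> unit_block n k v \<triangleleft> ?a"
  proof (rule finmat_eqI)
    fix i j
    have eq: "Poly_Mapping.lookup (F_adj ?a \<triangleright> unit_block n k v \<triangleleft> ?a) (i, j)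
        = (if i < 2 * m \<and> j < 2 * m then Poly_Mapping.lookup (unit_block n k v) (f i, f j) else 0)"
      by (simp add: lookup_ract_reindex lookup_lact_reindex)
    show "Poly_Mapping.lookup (unit_block m k v) (i, j)
        = Poly_Mapping.lookup (F_adj ?a \<triangleright> unit_block n k v \<triangleleft> ?a) (i, j)"
      unfolding eq lookup_unit_block using f[of i j] f[of j i] by auto
  qed
  then show "unit_block m k v \<in> P" using lim.P_compress[OF pos] by simp
next
  assume pos: "unit_block m k v \<in> P"
  \<comment> \<open>A consists of the indices coming from the smaller block, with g leading back to
    it; C is the rest, where only diagonal entries k e survive since v is supported in size
    m.\<close>
  define A where "A = {..<m} \<union> {n..<n + m}"
  define C where "C = {m..<n} \<union> {n + m..<2 * n}"
  define g where "g i = (if i < m then i else i - n + m)" for i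
  let ?b = "reindex_mat A g"
  let ?r = "\<Sum>i\<in>C. F_unit i 0 \<triangleright> lim.rscl k lunit \<triangleleft> F_unit 0 i"
  have fin: "finite A" "finite C" by (auto simp: A_def C_def)
  have AC: "i < 2 * n \<Longrightarrow> i \<notin> A \<longleftrightarrow> i \<in> C" "i \<in> A \<Longrightarrow> i < 2 * n" "i \<in> C \<Longrightarrow> i < 2 * n" for i
    using mn by (auto simp: A_def C_def)
  have g: "g i = g j \<longleftrightarrow> i = j" "g i < 2 * m" "g i < m \<longleftrightarrow> i < n" "m \<le> g i \<longleftrightarrow> n \<le> i"
    "i < n \<Longrightarrow> g i = i" "n \<le> i \<Longrightarrow> g i - m = i - n"
    if "i \<in> A" "j \<in> A" for i j
    using that mn by (auto simp: g_def A_def)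
  have off: "m \<le> i" if "i < n" "i \<notin> A" for i using that by (auto simp: A_def)
  have off': "m \<le> i - n" if "n \<le> i" "i \<notin> A" for i using that by (auto simp: A_def)
  have "unit_block n k v = (F_adj ?b \<triangleright> unit_block m k v \<triangleleft> ?b) + ?r"
  proof (rule finmat_eqI)
    fix i j
    have eq: "Poly_Mapping.lookup ((F_adj ?b \<triangleright> unit_block m k v \<triangleleft> ?b) + ?r) (i, j)
        = (if i \<in> A \<and> j \<in> A then Poly_Mapping.lookup (unit_block m k v) (g i, g j) else 0)
          + (if i = j \<and> i \<in> C then scale (of_real k) e else 0)"
      using fin by (auto simp: lookup_add lookup_ract_reindex lookup_lact_reindex lookup_diag_sum unit_mat_def)
    show "Poly_Mapping.lookup (unit_block n k v) (i, j)
        = Poly_Mapping.lookup ((F_adj ?b \<triangleright> unit_block m k v \<triangleleft> ?b) + ?r) (i, j)"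
    proof (cases "i \<in> A \<and> j \<in> A")
      case True
      then show ?thesis
        unfolding eq lookup_unit_block using g[of i j] g[of j i] AC[of i] AC[of j] by auto
    next
      case False
      have "Poly_Mapping.lookup v (i, j - n) = 0" if "i < n" "n \<le> j"
        using False off[of i] off'[of j] that by (intro supportedD[OF v]) auto
      moreover have "Poly_Mapping.lookup v (j, i - n) = 0" if "j < n" "n \<le> i"
        using False off[of j] off'[of i] that by (intro supportedD[OF v]) auto
      moreover have "i = j \<and> i < 2 * n \<longleftrightarrow> i = j \<and> i \<in> C"
        using False AC[of i] by auto
      ultimately show ?thesis
        unfolding eq if_not_P[OF False] lookup_unit_block by simp
    qed
  qed
  moreover have "F_adj ?b \<triangleright> unit_block m k v \<triangleleft> ?b \<in> P" by (rule lim.P_compress[OF pos])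
  moreover have "?r \<in> P"
    using lim.P_compress[OF P_rscl[OF lunit_pos k], of "F_unit 0 _"]
    by (intro P_sum) (simp add: F_unit_adj[of _ 0])
  ultimately show "unit_block n k v \<in> P" by (simp add: lim.P_add)
qed

end

context absolute_matrix_order_unit_space
begin

text \<open>All l beyond k are included so that the bounds for two elements can be met by one
  constant.\<close>

lemma lunit_dominates_pos:
  assumes v: "v \<in> P" and s: "supported 1 v"
  shows "\<exists>k>0. \<forall>l\<ge>k. lim.rscl l lunit - v \<in> P"
proof -
  have "corner 1 v \<in> msa 1"
    using mem_msa_corner[OF s] lim.P_sa[OF v] by simp
  then obtain k where k: "0 < k" "mat_scale scale k (unit_mat e 1) - corner 1 v \<in> cone 1"
    using order_unit by blast
  have sl: "supported 1 (lim.rscl k lunit)" by (intro supported_rscl supported_lim_map)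
  have c1: "corner 1 lunit = unit_mat e 1"
    by (rule corner_lim_map) (simp add: unit_mat_def)
  have pos: "lim.rscl k lunit - v \<in> P"
    using k(2) mem_lim_cone_iff[OF _ supported_minus[OF sl s]] 
    by (simp only: corner_minus corner_rscl c1 less_numeral_extra)
  have "lim.rscl l lunit - v \<in> P" if "k \<le> l" for l
  proof -
    have eq: "lim.rscl l lunit - v = (lim.rscl k lunit - v) + lim.rscl (l - k) lunit"
      by (rule finmat_eqI) (simp add: lookup_minus lookup_add scale_left_diff_distrib)
    show ?thesis
      unfolding eq by (rule lim.P_add[OF pos P_rscl[OF lunit_pos]]) (use that in simp)
  qed
  then show ?thesis using k(1) by blast
qed

lemma lim_order_unit: "local_F_order_unit_bimodule lact ract (lim_star star) P lunit"
proof unfold_locales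
  show "lunit \<in> P" by (rule lunit_pos)
  show "F_I 1 \<triangleright> lunit \<triangleleft> F_I 1 = lunit" unfolding compress_I_iff by (rule supported_lim_map)
  show "P \<inter> uminus ` P = {0}"
  proof (intro equalityI subsetI)
    fix x assume "x \<in> P \<inter> uminus ` P"
    then show "x \<in> {0}" using P_proper[of x] by auto
  qed (use P_zero in \<open>force simp: image_iff\<close>)
  show "v \<in> P" if "lim_star star v = v" "u \<in> P" "\<And>k. 0 < k \<Longrightarrow> lim.rscl k u + v \<in> P" for v u
    using that by (rule lim_archimedean)
  show "\<exists>k>0. lim.pair_pos 1 (lim.rscl k lunit) (lim.rscl k lunit) + lim.sa_part 1 v \<in> P"
    if "v = F_I 1 \<triangleright> w \<triangleleft> F_I 1" for v w
  proof -
    have s: "supported 1 v"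
      unfolding that by (rule supportedI) (auto simp: lim.lact_ract)
    \<comment> \<open>The order unit of the matrix space controls self-adjoint elements only. For
      general v it is made to dominate both absolute values, and block positivity is then added to
      exchange these for v itself.\<close>
    let ?a = "labs (lim_star star v)" and ?b = "labs v"
    have ab: "supported 1 ?a" "supported 1 ?b"
      using s by (auto intro: supported_labs supported_star)
    obtain k l where "0 < k" "\<forall>r\<ge>k. lim.rscl r lunit - ?a \<in> P" "\<forall>r\<ge>l. lim.rscl r lunit - ?b \<in> P"
      using lunit_dominates_pos[OF labs_pos ab(1)] lunit_dominates_pos[OF labs_pos ab(2)] by blast
    then obtain r where r: "0 < r" "lim.rscl r lunit - ?a \<in> P" "lim.rscl r lunit - ?b \<in> P"
      by (metis max.cobounded1 max.cobounded2 less_max_iff_disj)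
    have "lim.pair_pos 1 (lim.rscl r lunit) (lim.rscl r lunit) + lim.sa_part 1 v
        = lim.pair_pos 1 (lim.rscl r lunit - ?a) (lim.rscl r lunit - ?b)
          + (lim.pair_pos 1 ?a ?b + lim.sa_part 1 v)"
      by (simp add: pair_pos_minus)
    also have "\<dots> \<in> P"
      by (rule lim.P_add[OF P_pair_pos[OF r(2,3)] labs_block[OF _ s]]) simp
    finally show ?thesis using r(1) by blast
  qed
qed

sublocale lim: local_F_order_unit_bimodule lact ract "lim_star star" P lunit
  by (rule lim_order_unit)

section \<open>Norm and orthogonality read in a corner\<close>

text \<open>The sets of admissible k > 0 coincide, because positivity of the unit block does not
  change between the order of v and n; hence so do their infima.\<close>

lemma lim_nrm_eq:
  assumes n: "0 < n" and v: "supported n v"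
  shows "lim.nrm v = nrm n (corner n v)"
proof -
  have N: "0 < 2 * n" using n by simp
  have "unit_block (lim.elt_order v) k v \<in> P
      \<longleftrightarrow> four_block_mat (mat_scale scale k (unit_mat e n)) (corner n v)
        (mat_adj star (corner n v)) (mat_scale scale k (unit_mat e n)) \<in> cone (2 * n)"
    if k: "0 < k" for k
  proof -
    have u: "supported n (lim.rscl k (lim.corner_unit lunit n))"
      by (intro supported_rscl supported_corner_unit)
    have s: "supported (2 * n) (unit_block n k v)"
      unfolding unit_block_def by (intro supported_add supported_pair_pos u supported_sa_part)
    have "unit_block (lim.elt_order v) k v \<in> P \<longleftrightarrow> unit_block n k v \<in> P"
      using elt_order elt_order_le[OF n v] k by (intro unit_block_pos_mono) auto
    also have "\<dots> \<longleftrightarrow> corner (2 * n) (unit_block n k v) \<in> cone (2 * n)"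
      by (rule mem_lim_cone_iff[OF N s])
    also have "corner (2 * n) (unit_block n k v)
        = four_block_mat (mat_scale scale k (unit_mat e n)) (corner n v)
          (mat_adj star (corner n v)) (mat_scale scale k (unit_mat e n))"
      unfolding unit_block_def corner_pair_sa[OF u v] corner_rscl corner_corner_unit ..
    finally show ?thesis .
  qed
  then show ?thesis
    unfolding lim.nrm_def nrm_def Let_def unit_block_def by (intro arg_cong[of _ _ Inf]) auto
qed

text \<open>A combination of u and v may have smaller order than u or v, so the three norms are
  defined in different sizes; all of them can be computed in size n.\<close>

lemma lim_perp_inf_iff:
  assumes n: "0 < n" and u: "supported n u" and v: "supported n v"
  shows "lim.perp_inf u v \<longleftrightarrow> perp_inf n (corner n u) (corner n v)"
  unfolding lim.perp_inf_def perp_inf_def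
  by (simp add: lim_nrm_eq[OF n] supported_add supported_rscl u v del: One_nat_def)

lemma lim_perp_iff:
  assumes n: "0 < n" and u: "supported n u" and v: "supported n v"
  shows "lim.perp u v \<longleftrightarrow> perp n (corner n u) (corner n v)"
proof -
  note s = supported_labs[OF n supported_minus[OF u v]] supported_add[OF u v]
  have "labs (u - v) = u + v \<longleftrightarrow> corner n (labs (u - v)) = corner n (u + v)"
    using corner_inj[OF s] by metis
  then show ?thesis
    by (simp add: lim.perp_def perp_def corner_labs[OF n supported_minus[OF u v]])
qed

text \<open>The corner is chosen according to the direction: to test given u' and v' it must hold
  them together with u and v, whereas in the converse the test elements are matrices of the size
  chosen for u and v and are carried into the limit by \<open>lim_map\<close>.\<close>

lemma lim_perp_iff_perp_inf_abs:
  assumes u: "u \<in> P" and v: "v \<in> P"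
  shows "lim.perp u v \<longleftrightarrow> lim.perp_inf_abs u v"
proof
  assume perp: "lim.perp u v"
  show "lim.perp_inf_abs u v"
    unfolding lim.perp_inf_abs_def
  proof (intro ballI impI)
    fix u' v' assume pos: "u' \<in> P" "v' \<in> P" and le: "lim.le u' u" "lim.le v' v"
    obtain m where m: "supported m u" "supported m v" using ex_supported2[of 0 u v] by blast
    obtain n where "m \<le> n" and n: "0 < n" and s': "supported n u'" "supported n v'"
      using ex_supported2[of m u' v'] by blast
    with m have s: "supported n u" "supported n v" by (auto intro: supported_mono)
    note mem = mem_lim_cone_iff[OF n]
    have "perp_inf_abs n (corner n u) (corner n v)"
      using perp u v mem[OF s(1)] mem[OF s(2)] perp_iff[OF n] lim_perp_iff[OF n s] by blast
    then have "perp_inf n (corner n u') (corner n v')"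
      using pos le mem[OF s'(1)] mem[OF s'(2)] mem[OF supported_minus[OF s(1) s'(1)]]
        mem[OF supported_minus[OF s(2) s'(2)]]
      by (simp add: perp_inf_abs_def lim.le_def)
    then show "lim.perp_inf u' v'" using lim_perp_inf_iff[OF n s'] by simp
  qed
next
  assume perp: "lim.perp_inf_abs u v"
  obtain n where n: "0 < n" and s: "supported n u" "supported n v"
    using ex_supported2[of 0 u v] by blast
  note mem = mem_lim_cone_iff[OF n]
  have "perp_inf_abs n (corner n u) (corner n v)"
    unfolding perp_inf_abs_def
  proof (intro ballI impI)
    fix x y assume x: "x \<in> cone n" "corner n u - x \<in> cone n" and y: "y \<in> cone n" "corner n v - y \<in> cone n"
    let ?x = "lim_map n x" and ?y = "lim_map n y"
    have c: "corner n ?x = x" "corner n ?y = y"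
      using cone_carrier[OF n] x(1) y(1) by (auto simp: corner_lim_map)
    have "?x \<in> P" "?y \<in> P" using lim_map_in_cone[OF n] x(1) y(1) by auto
    moreover have "lim.le ?x u" "lim.le ?y v"
      using mem[OF supported_minus[OF s(1) supported_lim_map]] x(2)
        mem[OF supported_minus[OF s(2) supported_lim_map]] y(2)
      by (simp_all add: lim.le_def c)
    ultimately have "lim.perp_inf ?x ?y" using perp unfolding lim.perp_inf_abs_def by blast
    then show "perp_inf n x y"
      using lim_perp_inf_iff[OF n supported_lim_map supported_lim_map, of x y] by (simp add: c)
  qed
  then show "lim.perp u v"
    using u v mem[OF s(1)] mem[OF s(2)] perp_iff[OF n] lim_perp_iff[OF n s] by blast
qed

lemma lim_absolute_order_unital:
  "nondegenerate_absolute_order_unital_F_bimodule lact ract (lim_star star) P lunit labs"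
  by unfold_locales (rule lim_perp_iff_perp_inf_abs)

end

theorem corollary3p22:
  fixes scale :: "complex \<Rightarrow> 'v::ab_group_add \<Rightarrow> 'v"
    and star :: "'v \<Rightarrow> 'v"
    and cone :: "nat \<Rightarrow> 'v mat set"
    and e :: 'v
    and mav :: "nat \<Rightarrow> nat \<Rightarrow> 'v mat \<Rightarrow> 'v mat"
  assumes "absolute_matrix_order_unit_space scale star cone e mav"
  shows "nondegenerate_absolute_order_unital_F_bimodule
           (lim_lact scale) (lim_ract scale) (lim_star star) (lim_cone cone)
           (lim_map 1 (unit_mat e 1)) (lim_abs scale mav)"
  using assms by (rule absolute_matrix_order_unit_space.lim_absolute_order_unital)

end
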